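(* There exists $\varepsilon\in(0,1/2]$ such that for every constant $C>0$ there is a function $r=r(n)$ with $r(n)\geq C(\log n/n)^{1/2}$ for all $n$ for which it is not true that, with probability tending to $1$ as $n\to\infty$, all $(1/2+\varepsilon)$-subgraphs of $T_2(n,r(n))$ are Hamiltonian.
   Context: $T_2(n,r)$ is the random geometric graph defined as follows: sample $n$ independent uniformly random points of the $2$-dimensional torus $(\mathbb{R}/\mathbb{Z})^2$ as the vertices, and add an edge between any two vertices whose Euclidean distance in the torus is at most $r$. For a real number $\beta$, a subgraph $H$ of a graph $G$ is a $\beta$-subgraph of $G$ if $d_H(v)\geq \beta\, d_G(v)$ for all $v\in V(G)$. A graph is Hamiltonian if it contains a Hamilton cycle. *)

theory Defs
  imports "HOL-Probability.Probability"
begin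

record 'a sgraph =
  verts :: "'a set"
  edges :: "'a set set"

definition simple_graph :: "'a sgraph \<Rightarrow> bool" where
  "simple_graph G \<longleftrightarrow>
     finite (verts G) \<and> (\<forall>e\<in>edges G. e \<subseteq> verts G \<and> card e = 2)"

definition degree :: "'a sgraph \<Rightarrow> 'a \<Rightarrow> nat" where
  "degree G v = card {e \<in> edges G. v \<in> e}"

definition subgraph :: "'a sgraph \<Rightarrow> 'a sgraph \<Rightarrow> bool" where
  "subgraph H G \<longleftrightarrow>
     simple_graph H \<and> simple_graph G \<and> verts H \<subseteq> verts G \<and> edges H \<subseteq> edges G"

text \<open>The degree in \<open>H\<close> of every vertex of \<open>G\<close> has to be defined, so \<open>H\<close> is spanning.\<close>

definition beta_subgraph :: "real \<Rightarrow> 'a sgraph \<Rightarrow> 'a sgraph \<Rightarrow> bool" where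
  "beta_subgraph \<beta> H G \<longleftrightarrow>
     subgraph H G \<and>
     (\<forall>v\<in>verts G. v \<in> verts H \<and> real (degree H v) \<ge> \<beta> * real (degree G v))"

text \<open>A Hamilton cycle is given by its cyclic sequence of vertices; a cycle has at least three.\<close>

definition hamilton_cycle :: "'a sgraph \<Rightarrow> 'a list \<Rightarrow> bool" where
  "hamilton_cycle G p \<longleftrightarrow>
     distinct p \<and> set p = verts G \<and> length p \<ge> 3 \<and>
     (\<forall>i<length p. {p ! i, p ! (Suc i mod length p)} \<in> edges G)"

definition hamiltonian :: "'a sgraph \<Rightarrow> bool" where
  "hamiltonian G \<longleftrightarrow> (\<exists>p. hamilton_cycle G p)"

text \<open>Points of the torus \<open>(\<real>/\<int>)\<^sup>2\<close> are given by representatives in the plane. The distance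
  is the quotient metric, which depends only on the classes of \<open>x\<close> and \<open>y\<close>, and a uniform
  point of the torus is the class of a uniform point of the fundamental domain \<open>[0,1)\<^sup>2\<close>.\<close>

definition torus_dist :: "real \<times> real \<Rightarrow> real \<times> real \<Rightarrow> real" where
  "torus_dist x y = (INF (a, b) \<in> (UNIV :: (int \<times> int) set). dist x (y + (of_int a, of_int b)))"

definition torus_uniform :: "(real \<times> real) measure" where
  "torus_uniform = uniform_measure lborel ({0..<1} \<times> {0..<1})"

definition torus_sample :: "nat \<Rightarrow> (nat \<Rightarrow> real \<times> real) measure" where
  "torus_sample n = (\<Pi>\<^sub>M i\<in>{..<n}. torus_uniform)"

text \<open>Vertex \<open>i\<close> stands for the \<open>i\<close>-th sampled point \<open>x i\<close>, so that \<open>T\<^sub>2(n,r)\<close> is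
  \<open>geometric_graph n r x\<close> with \<open>x\<close> distributed as \<open>torus_sample n\<close>.\<close>

definition geometric_graph :: "nat \<Rightarrow> real \<Rightarrow> (nat \<Rightarrow> real \<times> real) \<Rightarrow> nat sgraph" where
  "geometric_graph n r x =
     \<lparr>verts = {..<n},
      edges = {{i, j} | i j. i < n \<and> j < n \<and> i \<noteq> j \<and> torus_dist (x i) (x j) \<le> r}\<rparr>"

end

theory Submission
  imports Defs
begin

text \<open>For fixed \<open>r\<close> slightly below \<open>\<surd>2 / 2\<close>, a point \<open>v\<close> of the torus fails to see only a small
  region \<open>N(v)\<close> around its antipode \<open>w = v + (1/2, 1/2)\<close>, and the point reflection \<open>y \<mapsto> 2v - y\<close>
  preserves \<open>N(v)\<close>. Remove from the torus two disjoint antipodal discs (the holes) of total area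
  slightly less than \<open>1/2\<close>, leaving a set \<open>S\<close> of area slightly more than \<open>1/2\<close>. If \<open>v \<in> S\<close> then
  \<open>w \<in> S\<close>, so by convexity the reflection maps the part of \<open>N(v)\<close> inside the holes into \<open>S\<close>;
  as discs are strictly convex, it misses a little ball next to \<open>w\<close> in tangential direction.
  Hence \<open>v\<close> fails to see noticeably more of \<open>S\<close> than of the holes. Since \<open>S\<close> and the holes have
  almost the same area, \<open>v\<close> then sees noticeably more of the holes than of \<open>S\<close>. By the law of
  large numbers, deleting all edges inside \<open>S\<close> leaves a \<open>(1/2 + \<epsilon>)\<close>-subgraph in which
  \<open>S\<close> is an independent set of more than \<open>n/2\<close> vertices, so it has no Hamilton cycle.
  Uniformity in \<open>v\<close> comes from a finite net of \<open>S\<close> and two radii slightly below and above \<open>r\<close>.\<close>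

section \<open>The torus metric\<close>

definition lattice :: "(real \<times> real) set" where
  "lattice = \<int> \<times> \<int>"

definition torus_norm :: "real \<times> real \<Rightarrow> real" where
  "torus_norm u = torus_dist u 0"

definition centre :: "real \<times> real" where
  "centre = (1 / 2, 1 / 2)"

lemma lattice_closed:
  shows zero_lattice: "0 \<in> lattice"
    and add_lattice: "x \<in> lattice \<Longrightarrow> y \<in> lattice \<Longrightarrow> x + y \<in> lattice"
    and diff_lattice: "x \<in> lattice \<Longrightarrow> y \<in> lattice \<Longrightarrow> x - y \<in> lattice"
    and minus_lattice: "x \<in> lattice \<Longrightarrow> - x \<in> lattice"
  by (auto simp: lattice_def zero_prod_def)

lemma two_centre_lattice: "2 *\<^sub>R centre \<in> lattice"
  by (simp add: lattice_def centre_def)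

lemma lattice_conv_range: "lattice = range (\<lambda>(a::int, b::int). (of_int a, of_int b))"
  by (auto simp: lattice_def image_iff elim!: Ints_cases)

lemma countable_lattice: "countable lattice"
  unfolding lattice_conv_range by (rule countable_image) auto

lemma torus_dist_le:
  assumes "z \<in> lattice"
  shows "torus_dist x y \<le> norm (x - y - z)"
proof -
  obtain a b where z: "z = (of_int a, of_int b)"
    using assms by (auto simp: lattice_def elim!: Ints_cases)
  have "torus_dist x y \<le> (\<lambda>(a::int, b::int). dist x (y + (of_int a, of_int b))) (a, b)"
    unfolding torus_dist_def by (rule cINF_lower) (auto intro!: bdd_belowI2[of _ 0])
  thus ?thesis
    by (simp add: z dist_norm algebra_simps)
qed

text \<open>Rounding each coordinate of \<open>x - y\<close> to a nearest integer minimises both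
  coordinates at once, so the infimum is a minimum. The coordinate bounds are recorded because they
  confine the representative to the centred unit square.\<close>

lemma torus_dist_attained:
  obtains z where "z \<in> lattice" "torus_dist x y = norm (x - y - z)"
    "\<bar>fst (x - y - z)\<bar> \<le> 1 / 2" "\<bar>snd (x - y - z)\<bar> \<le> 1 / 2"
proof -
  define z :: "real \<times> real"
    where "z = (of_int (round (fst (x - y))), of_int (round (snd (x - y))))"
  have z: "z \<in> lattice"
    by (simp add: z_def lattice_def)
  have b: "\<bar>fst (x - y - z)\<bar> \<le> 1 / 2" "\<bar>snd (x - y - z)\<bar> \<le> 1 / 2"
    using of_int_round_abs_le[of "fst (x - y)"] of_int_round_abs_le[of "snd (x - y)"]
    by (auto simp: z_def abs_minus_commute)
  have "norm (x - y - z) \<le> dist x (y + (of_int a, of_int b))" for a b :: int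
  proof -
    have 1: "\<bar>fst (x - y - z)\<bar> \<le> \<bar>fst (x - y) - of_int a\<bar>"
      using round_diff_minimal[of "fst (x - y)" a] by (simp add: z_def)
    have 2: "\<bar>snd (x - y - z)\<bar> \<le> \<bar>snd (x - y) - of_int b\<bar>"
      using round_diff_minimal[of "snd (x - y)" b] by (simp add: z_def)
    have "norm (x - y - z) = sqrt (\<bar>fst (x - y - z)\<bar>\<^sup>2 + \<bar>snd (x - y - z)\<bar>\<^sup>2)"
      by (simp add: norm_prod_def)
    also have "\<dots> \<le> sqrt (\<bar>fst (x - y) - of_int a\<bar>\<^sup>2 + \<bar>snd (x - y) - of_int b\<bar>\<^sup>2)"
      using 1 2 by (intro real_sqrt_le_mono add_mono power_mono) auto
    also have "\<dots> = norm (x - (y + (of_int a, of_int b)))"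
      by (simp add: norm_prod_def diff_diff_eq)
    finally show ?thesis
      by (simp add: dist_norm)
  qed
  hence "norm (x - y - z) \<le> torus_dist x y"
    unfolding torus_dist_def by (intro cINF_greatest) auto
  with torus_dist_le[OF z, of x y] z b show ?thesis
    by (intro that[of z]) auto
qed

lemma torus_dist_eq_norm: "torus_dist x y = torus_norm (x - y)"
  by (simp add: torus_norm_def torus_dist_def dist_norm diff_diff_eq[symmetric])

lemma torus_norm_le: "z \<in> lattice \<Longrightarrow> torus_norm u \<le> norm (u - z)"
  using torus_dist_le[of z u 0] by (simp add: torus_norm_def)

lemma torus_norm_le_norm: "torus_norm u \<le> norm u"
  using torus_norm_le[OF zero_lattice] by simp

lemma torus_norm_attained:
  obtains z where "z \<in> lattice" "torus_norm u = norm (u - z)"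
    "\<bar>fst (u - z)\<bar> \<le> 1 / 2" "\<bar>snd (u - z)\<bar> \<le> 1 / 2"
  using torus_dist_attained[of u 0] by (simp add: torus_norm_def) metis

lemma torus_norm_less_iff: "torus_norm u < s \<longleftrightarrow> (\<exists>z\<in>lattice. norm (u - z) < s)"
  by (metis torus_norm_attained torus_norm_le order.strict_trans1)

lemma torus_norm_minus_lattice:
  assumes "z \<in> lattice"
  shows "torus_norm (u - z) = torus_norm u"
proof (rule antisym)
  obtain y where "y \<in> lattice" "torus_norm u = norm (u - y)"
    using torus_norm_attained by metis
  thus "torus_norm (u - z) \<le> torus_norm u"
    using torus_norm_le[of "y - z" "u - z"] assms by (simp add: diff_lattice)
next
  obtain y where "y \<in> lattice" "torus_norm (u - z) = norm (u - z - y)"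
    using torus_norm_attained by metis
  thus "torus_norm u \<le> torus_norm (u - z)"
    using torus_norm_le[of "z + y" u] assms by (simp add: add_lattice diff_diff_eq)
qed

lemma torus_norm_plus_lattice: "z \<in> lattice \<Longrightarrow> torus_norm (u + z) = torus_norm u"
  using torus_norm_minus_lattice[of "- z" u] by (simp add: minus_lattice)

lemma torus_norm_minus: "torus_norm (- u) = torus_norm u"
proof -
  have "torus_norm (- u) \<le> torus_norm u" for u
  proof -
    obtain y where "y \<in> lattice" "torus_norm u = norm (u - y)"
      using torus_norm_attained by metis
    thus ?thesis
      using torus_norm_le[of "- y" "- u"] by (simp add: minus_lattice norm_minus_commute)
  qed
  from this[of u] this[of "- u"] show ?thesis by simp
qed

lemma torus_norm_minus_commute: "torus_norm (u - v) = torus_norm (v - u)"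
  using torus_norm_minus[of "u - v"] by simp

lemma torus_norm_triangle: "torus_norm (u + v) \<le> torus_norm u + torus_norm v"
proof -
  obtain y z where "y \<in> lattice" "torus_norm u = norm (u - y)"
      "z \<in> lattice" "torus_norm v = norm (v - z)"
    using torus_norm_attained by metis
  thus ?thesis
    using torus_norm_le[of "y + z" "u + v"] norm_triangle_ineq[of "u - y" "v - z"]
    by (simp add: add_lattice algebra_simps)
qed

lemma torus_norm_triangle_sub: "torus_norm u \<le> torus_norm v + torus_norm (u - v)"
  using torus_norm_triangle[of v "u - v"] by simp

lemma continuous_on_torus_norm: "continuous_on A torus_norm"
proof (rule continuous_onI)
  fix x e assume "(e::real) > 0"
  have "dist (torus_norm y) (torus_norm x) \<le> dist y x" for y
    using torus_norm_triangle_sub[of x y] torus_norm_triangle_sub[of y x]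
      torus_norm_le_norm[of "x - y"] torus_norm_le_norm[of "y - x"]
    by (simp add: dist_norm norm_minus_commute abs_le_iff)
  thus "\<exists>d>0. \<forall>y\<in>A. dist y x < d \<longrightarrow> dist (torus_norm y) (torus_norm x) \<le> e"
    using \<open>e > 0\<close> by (meson less_imp_le order_trans)
qed

lemma borel_torus_norm [measurable]: "torus_norm \<in> borel_measurable borel"
  by (rule borel_measurable_continuous_onI[OF continuous_on_torus_norm])

text \<open>Only points near the antipode of 0 are this far from 0. With \<open>(a, b)\<close> the
  offset from the antipode, some corner of the unit cell is at distance \<open>sqrt ((1/2 -
  \<bar>a\<bar>)\<^sup>2 + (1/2 - \<bar>b\<bar>)\<^sup>2)\<close>. If the offset has length at least
  0.06, the square of this is at most 0.4436, while 0.667 squared is about 0.4449.\<close>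

lemma torus_norm_diff_centre_less:
  assumes "torus_norm u > s" "s \<ge> 667 / 1000"
  shows "torus_norm (u - centre) < 6 / 100"
proof (rule ccontr)
  assume neg: "\<not> ?thesis"
  obtain z where z: "z \<in> lattice" "torus_norm (u - centre) = norm (u - centre - z)"
    "\<bar>fst (u - centre - z)\<bar> \<le> 1 / 2" "\<bar>snd (u - centre - z)\<bar> \<le> 1 / 2"
    by (rule torus_norm_attained)
  obtain a b where ab: "u - centre - z = (a, b)" by (metis surj_pair)
  have u: "u = (a, b) + centre + z" using ab by (simp add: algebra_simps)
  have ab_le: "\<bar>a\<bar> \<le> 1 / 2" "\<bar>b\<bar> \<le> 1 / 2" using z(3,4) by (auto simp: ab)
  have "sqrt (a\<^sup>2 + b\<^sup>2) \<ge> 6 / 100"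
    using neg z(2) by (simp add: ab norm_prod_def)
  also have "sqrt (a\<^sup>2 + b\<^sup>2) \<le> \<bar>a\<bar> + \<bar>b\<bar>"
    by (rule sqrt_sum_squares_le_sum_abs)
  finally have sum: "\<bar>a\<bar> + \<bar>b\<bar> \<ge> 6 / 100" .
  \<comment> \<open>The corner of the unit square closest to
    \<open>u - z = (a + 1/2, b + 1/2)\<close>.\<close>
  define c where "c = (if a \<ge> 0 then 1 else 0 :: real, if b \<ge> 0 then 1 else 0 :: real)"
  have "c + z \<in> lattice"
    using z(1) by (auto simp: c_def lattice_def)
  hence "torus_norm u \<le> norm (u - (c + z))" by (rule torus_norm_le)
  also have "u - (c + z) = (a + 1 / 2 - fst c, b + 1 / 2 - snd c)"
    by (simp add: u centre_def prod_eq_iff)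
  also have "norm \<dots> = sqrt ((1 / 2 - \<bar>a\<bar>)\<^sup>2 + (1 / 2 - \<bar>b\<bar>)\<^sup>2)"
  proof -
    have "(a + 1 / 2 - fst c)\<^sup>2 = (1 / 2 - \<bar>a\<bar>)\<^sup>2" "(b + 1 / 2 - snd c)\<^sup>2 = (1 / 2 - \<bar>b\<bar>)\<^sup>2"
      by (auto simp: c_def power2_eq_square algebra_simps)
    thus ?thesis by (simp only: norm_prod_def fst_conv snd_conv real_norm_def power2_abs)
  qed
  finally have "s < sqrt ((1 / 2 - \<bar>a\<bar>)\<^sup>2 + (1 / 2 - \<bar>b\<bar>)\<^sup>2)"
    using assms by simp
  hence "667 / 1000 < sqrt ((1 / 2 - \<bar>a\<bar>)\<^sup>2 + (1 / 2 - \<bar>b\<bar>)\<^sup>2)"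
    using assms(2) by simp
  hence "(667 / 1000)\<^sup>2 < (1 / 2 - \<bar>a\<bar>)\<^sup>2 + (1 / 2 - \<bar>b\<bar>)\<^sup>2"
    using real_le_lsqrt[of "667 / 1000"] by (meson not_less zero_le_divide_iff zero_le_numeral)
  moreover have "(1 / 2 - \<bar>a\<bar>)\<^sup>2 + (1 / 2 - \<bar>b\<bar>)\<^sup>2 \<le> 4436 / 10000"
  proof -
    define p q where "p = \<bar>a\<bar>" and "q = \<bar>b\<bar>"
    have pq: "0 \<le> p" "p \<le> 1/2" "0 \<le> q" "q \<le> 1/2" "p + q \<ge> 6 / 100"
      using ab_le sum by (auto simp: p_def q_def)
    have "(1 / 2 - p)\<^sup>2 + (1 / 2 - q)\<^sup>2 = 1 / 2 - (p + q) + p\<^sup>2 + q\<^sup>2"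
      by (simp add: power2_eq_square algebra_simps)
    also have "\<dots> \<le> 4436 / 10000"
    proof (cases "p + q \<le> 1 / 2")
      case True
      have "p\<^sup>2 + q\<^sup>2 \<le> (p + q)\<^sup>2" using pq by (simp add: power2_sum)
      moreover have "m\<^sup>2 \<le> m - 564 / 10000" if "6 / 100 \<le> m" "m \<le> 1 / 2" for m :: real
      proof -
        \<comment> \<open>The roots 0.06 and 0.94 have sum 1 and product 0.0564 = 1/2 -
          0.4436.\<close>
        have "(m - 6 / 100) * (94 / 100 - m) \<ge> 0"
          using that by (intro mult_nonneg_nonneg) auto
        moreover have "(m - 6 / 100) * (94 / 100 - m) = m - 564 / 10000 - m\<^sup>2"
          by (simp add: field_simps power2_eq_square)
        ultimately show ?thesis by linarith
      qed
      from this[OF pq(5) True] have "(p + q)\<^sup>2 \<le> (p + q) - 564 / 10000" .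
      ultimately show ?thesis by linarith
    next
      case False
      \<comment> \<open>Each square is at most half of its base, so the sum is at most
        \<open>1/2 - (p + q)/2\<close>, which is below 1/4.\<close>
      have "p * (1 / 2 - p) \<ge> 0" "q * (1 / 2 - q) \<ge> 0" using pq by auto
      with False show ?thesis by (simp add: power2_eq_square algebra_simps)
    qed
    finally show ?thesis by (simp add: p_def q_def)
  qed
  ultimately show False by (simp add: power2_eq_square)
qed

text \<open>Both coordinates of the difference are half-integers, so each has square at least
  1/4.\<close>

lemma norm_lattice_diff_centre:
  assumes "z \<in> lattice"
  shows "norm (centre - z) \<ge> sqrt 2 / 2"
proof -
  obtain a b where z: "z = (of_int a, of_int b)"
    using assms by (auto simp: lattice_def elim!: Ints_cases)
  have *: "(1 / 2 - of_int k :: real)\<^sup>2 \<ge> 1 / 4" for k :: int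
  proof -
    have "(1 / 2 - of_int k :: real)\<^sup>2 = 1 / 4 + of_int (k * (k - 1))"
      by (simp add: power2_eq_square algebra_simps)
    moreover have "k * (k - 1) \<ge> 0"
      by (cases "k \<ge> 1") (auto intro: mult_nonneg_nonneg mult_nonpos_nonpos)
    ultimately show ?thesis by linarith
  qed
  have "sqrt (1 / 2) \<le> sqrt ((1 / 2 - of_int a)\<^sup>2 + (1 / 2 - of_int b)\<^sup>2)"
    using *[of a] *[of b] by (intro real_sqrt_le_mono) linarith
  thus ?thesis by (simp add: z centre_def norm_prod_def real_sqrt_divide real_div_sqrt field_simps)
qed

lemma torus_norm_centre: "torus_norm centre \<ge> sqrt 2 / 2"
  by (metis torus_norm_attained norm_lattice_diff_centre)

section \<open>The group of hole centres: all lifts of 0 and of its antipode\<close>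

definition dlattice :: "(real \<times> real) set" where
  "dlattice = lattice \<union> (+) centre ` lattice"

lemma dlattice_iff: "x \<in> dlattice \<longleftrightarrow> x \<in> lattice \<or> x - centre \<in> lattice"
  by (force simp: dlattice_def image_iff)

lemma centre_dlattice: "centre \<in> dlattice"
  by (simp add: dlattice_iff zero_lattice)

lemma lattice_dlattice: "z \<in> lattice \<Longrightarrow> z \<in> dlattice"
  by (simp add: dlattice_iff)

text \<open>The two cosets form a group because twice \<open>centre\<close> is a lattice vector.
  This makes the holes invariant under passing to the antipode.\<close>

lemma diff_dlattice:
  assumes "x \<in> dlattice" "y \<in> dlattice"
  shows "x - y \<in> dlattice"
proof -
  have 1: "x - y = (x - centre) - (y - centre)" "x - y - centre = (x - centre) - y"
    by simp_all
  have 2: "x - y - centre = x - (y - centre) - 2 *\<^sub>R centre"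
    by (simp add: scaleR_2)
  show ?thesis
    using assms unfolding dlattice_iff
    by (metis 1 2 diff_lattice two_centre_lattice)
qed

lemma add_dlattice: "x \<in> dlattice \<Longrightarrow> y \<in> dlattice \<Longrightarrow> x + y \<in> dlattice"
  using diff_dlattice[of x "0 - y"] diff_dlattice[of 0 y] lattice_dlattice[OF zero_lattice] by simp

text \<open>Separation of the hole centres: nonzero lattice vectors have length at least 1, and
  vectors of the other coset have half-integer coordinates.\<close>

lemma norm_dlattice:
  assumes "x \<in> dlattice" "x \<noteq> 0"
  shows "norm x \<ge> sqrt 2 / 2"
proof (cases "x \<in> lattice")
  case True
  then obtain a b where x: "x = (of_int a, of_int b)"
    by (auto simp: lattice_def elim!: Ints_cases)
  have "\<bar>a\<bar> \<ge> 1 \<or> \<bar>b\<bar> \<ge> 1" using x assms(2) by (auto simp: zero_prod_def)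
  hence "\<bar>fst x\<bar> \<ge> 1 \<or> \<bar>snd x\<bar> \<ge> 1" by (simp add: x) linarith
  moreover have "\<bar>fst x\<bar> \<le> norm x" "\<bar>snd x\<bar> \<le> norm x"
    by (simp_all add: x norm_prod_def)
  moreover have "sqrt 2 \<le> 2" by (rule real_le_lsqrt) auto
  ultimately show ?thesis by linarith
next
  case False
  with assms have "centre - x \<in> lattice"
    by (metis dlattice_iff minus_diff_eq minus_lattice)
  with norm_lattice_diff_centre[of "centre - x"] show ?thesis by simp
qed

section \<open>The uniform measure on the torus\<close>

definition fund :: "(real \<times> real) set" where
  "fund = {0..<1} \<times> {0..<1}"

lemma fund_borel [measurable]: "fund \<in> sets borel"
  unfolding fund_def by (intro borel_Times) auto

lemma fund_translate_unique:
  assumes "y \<in> lattice" "z \<in> lattice" "x - y \<in> fund" "x - z \<in> fund"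
  shows "y = z"
proof -
  obtain a b c d where "y = (of_int a, of_int b)" "z = (of_int c, of_int d)"
    using assms by (auto simp: lattice_def elim!: Ints_cases)
  moreover obtain s t where "x = (s, t)" by (metis surj_pair)
  ultimately show ?thesis
    using assms(3,4) by (auto simp: fund_def)
qed

lemma fund_translate_exists: "\<exists>z\<in>lattice. x - z \<in> fund"
  by (intro bexI[of _ "(of_int \<lfloor>fst x\<rfloor>, of_int \<lfloor>snd x\<rfloor>)"])
     (auto simp: fund_def lattice_def minus_prod_def intro: Ints_of_int, (linarith+)?)

section \<open>Areas of lattice-periodic sets and their invariance\<close>

lemma emeasure_lborel_translate:
  fixes A :: "'a::euclidean_space set"
  assumes [measurable]: "A \<in> sets borel"
  shows "emeasure lborel ((\<lambda>x. t + x) -` A) = emeasure lborel A"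
proof -
  have "emeasure lborel A = emeasure (distr lborel borel (\<lambda>x. t + x)) A"
    using lborel_affine[of 1 t] by (simp add: density_1)
  thus ?thesis by (simp add: emeasure_distr)
qed

lemma emeasure_lborel_reflect:
  fixes A :: "'a::euclidean_space set"
  assumes [measurable]: "A \<in> sets borel"
  shows "emeasure lborel ((\<lambda>x. t - x) -` A) = emeasure lborel A"
proof -
  have "emeasure lborel A = emeasure (distr lborel borel (\<lambda>x. t - x)) A"
    using lborel_affine[of "-1" t] by (simp add: density_1)
  thus ?thesis by (simp add: emeasure_distr)
qed

text \<open>A periodic set has the same area in every fundamental domain. The piece
  \<open>X z\<close> of \<open>A \<inter> F\<close> in the translate of \<open>fund\<close> by
  \<open>z\<close> is moved back into \<open>fund\<close>, where it becomes \<open>Y z\<close>; both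
  families are countable partitions.\<close>

lemma emeasure_fundamental_domain:
  assumes [measurable]: "A \<in> sets borel" "F \<in> sets borel"
    and periodic: "\<And>x z. z \<in> lattice \<Longrightarrow> x + z \<in> A \<longleftrightarrow> x \<in> A"
    and unique: "\<And>x. \<exists>!z. z \<in> lattice \<and> x + z \<in> F"
  shows "emeasure lborel (A \<inter> F) = emeasure lborel (A \<inter> fund)"
proof -
  define X where "X z = A \<inter> F \<inter> (\<lambda>x. - z + x) -` fund" for z
  define Y where "Y z = A \<inter> (\<lambda>x. z + x) -` F \<inter> fund" for z
  have [measurable]: "X z \<in> sets borel" "Y z \<in> sets borel" for z
    unfolding X_def Y_def by measurable
  have XY: "(\<lambda>x. z + x) -` X z = Y z" if "z \<in> lattice" for z
    unfolding X_def Y_def by (rule set_eqI) (use periodic[OF that] in \<open>auto simp: add.commute simp del: split_paired_All\<close>)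
  have "A \<inter> F = (\<Union>z\<in>lattice. X z)"
    using fund_translate_exists by (auto simp: X_def algebra_simps)
  moreover have "disjoint_family_on X lattice"
  unfolding disjoint_family_on_def
proof (intro ballI impI)
    fix y z assume yz: "y \<in> lattice" "z \<in> lattice" "y \<noteq> z"
    have "\<not> (x - y \<in> fund \<and> x - z \<in> fund)" for x
      using fund_translate_unique[OF yz(1,2)] yz(3) by blast
    thus "X y \<inter> X z = {}"
      unfolding X_def by (simp add: set_eq_iff del: split_paired_All)
  qed
  ultimately have "emeasure lborel (A \<inter> F) = (\<integral>\<^sup>+z. emeasure lborel (X z) \<partial>count_space lattice)"
    by (simp add: emeasure_UN_countable countable_lattice)
  also have "\<dots> = (\<integral>\<^sup>+z. emeasure lborel (Y z) \<partial>count_space lattice)"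
  proof (intro nn_integral_cong)
    fix z :: "real \<times> real" assume "z \<in> space (count_space lattice)"
    hence "Y z = (\<lambda>x. z + x) -` X z" using XY by simp
    thus "emeasure lborel (X z) = emeasure lborel (Y z)"
      by (simp only: emeasure_lborel_translate \<open>\<And>z. X z \<in> sets borel\<close>)
  qed
  also have "\<dots> = emeasure lborel (\<Union>z\<in>lattice. Y z)"
  proof (rule emeasure_UN_countable[symmetric])
    show "disjoint_family_on Y lattice"
    unfolding disjoint_family_on_def
proof (intro ballI impI)
      fix y z assume yz: "y \<in> lattice" "z \<in> lattice" "y \<noteq> z"
      have "\<not> (y + x \<in> F \<and> z + x \<in> F)" for x
        using unique[of x] yz unfolding add.commute[of _ x] by blast
      thus "Y y \<inter> Y z = {}"
        unfolding Y_def by blast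
    qed
  qed (auto simp: countable_lattice)
  also have "(\<Union>z\<in>lattice. Y z) = A \<inter> fund"
  proof (rule set_eqI)
    fix x
    obtain z where "z \<in> lattice" "x + z \<in> F"
      using unique[of x] by blast
    thus "x \<in> (\<Union>z\<in>lattice. Y z) \<longleftrightarrow> x \<in> A \<inter> fund"
      by (auto simp: Y_def add.commute simp del: split_paired_Ex)
  qed
  finally show ?thesis .
qed

lemma emeasure_fund: "emeasure lborel fund = 1"
proof -
  have "emeasure lborel fund = emeasure (lborel \<Otimes>\<^sub>M lborel) ({0..<1::real} \<times> {0..<1::real})"
    by (simp add: fund_def lborel_prod)
  also have "\<dots> = 1"
    by (subst lborel.emeasure_pair_measure_Times) auto
  finally show ?thesis .
qed

lemma prob_space_torus_uniform: "prob_space torus_uniform"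
  unfolding torus_uniform_def fund_def[symmetric]
  by (rule prob_space_uniform_measure) (auto simp: emeasure_fund)

interpretation torus: prob_space torus_uniform
  by (rule prob_space_torus_uniform)

lemma sets_torus_uniform [measurable_cong, simp]: "sets torus_uniform = sets borel"
  by (simp add: torus_uniform_def)

lemma space_torus_uniform [simp]: "space torus_uniform = UNIV"
  by (simp add: torus_uniform_def)

lemma measure_torus_uniform:
  assumes "A \<in> sets borel"
  shows "measure torus_uniform A = measure lborel (A \<inter> fund)"
  using assms unfolding torus_uniform_def fund_def[symmetric]
  by (subst measure_uniform_measure) (auto simp: emeasure_fund measure_def Int_commute)

lemma measure_torus_uniform_domain:
  assumes "A \<in> sets borel" "F \<in> sets borel"
    and "\<And>x z. z \<in> lattice \<Longrightarrow> x + z \<in> A \<longleftrightarrow> x \<in> A"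
    and "\<And>x. \<exists>!z. z \<in> lattice \<and> x + z \<in> F"
  shows "measure torus_uniform A = measure lborel (A \<inter> F)"
  using emeasure_fundamental_domain[OF assms] assms(1)
  unfolding measure_torus_uniform[OF assms(1)] by (simp only: measure_def)

text \<open>Translating moves \<open>fund\<close> off itself, but the image is again a fundamental
  domain, so periodicity of \<open>A\<close> restores the area. Reflections are treated in the same
  way below.\<close>

lemma measure_torus_translate:
  assumes [measurable]: "A \<in> sets borel"
    and periodic: "\<And>x z. z \<in> lattice \<Longrightarrow> x + z \<in> A \<longleftrightarrow> x \<in> A"
  shows "measure torus_uniform {x. t + x \<in> A} = measure torus_uniform A"
proof -
  have dom: "(\<lambda>x. - t + x) -` fund \<in> sets borel"
    by (rule measurable_sets_borel[OF _ fund_borel]) simp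
  hence sets: "A \<inter> (\<lambda>x. - t + x) -` fund \<in> sets borel" "{x. t + x \<in> A} \<in> sets borel"
    by measurable
  have eq: "{x. t + x \<in> A} \<inter> fund = (\<lambda>x. t + x) -` (A \<inter> (\<lambda>x. - t + x) -` fund)"
    by (rule set_eqI) simp
  have "measure torus_uniform {x. t + x \<in> A} = measure lborel ({x. t + x \<in> A} \<inter> fund)"
    by (rule measure_torus_uniform[OF sets(2)])
  also have "\<dots> = measure lborel (A \<inter> (\<lambda>x. - t + x) -` fund)"
    unfolding measure_def eq emeasure_lborel_translate[OF sets(1)] by (rule refl)
  also have "\<dots> = measure torus_uniform A"
  proof (rule measure_torus_uniform_domain[symmetric])
    fix x
    obtain z where z: "z \<in> lattice" "x - t - z \<in> fund"
      using fund_translate_exists by blast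
    show "\<exists>!z. z \<in> lattice \<and> x + z \<in> (\<lambda>x. - t + x) -` fund"
    proof (rule ex1I[of _ "- z"])
      fix y assume "y \<in> lattice \<and> x + y \<in> (\<lambda>x. - t + x) -` fund"
      thus "y = - z"
        using fund_translate_unique[of "- y" z "x - t"] z by (auto simp: minus_lattice algebra_simps)
    qed (use z in \<open>auto simp: minus_lattice algebra_simps\<close>)
  qed (rule assms dom | assumption)+
  finally show ?thesis .
qed

lemma measure_torus_reflect:
  assumes [measurable]: "A \<in> sets borel"
    and periodic: "\<And>x z. z \<in> lattice \<Longrightarrow> x + z \<in> A \<longleftrightarrow> x \<in> A"
  shows "measure torus_uniform {x. t - x \<in> A} = measure torus_uniform A"
proof -
  have dom: "(\<lambda>x. t - x) -` fund \<in> sets borel"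
    by (rule measurable_sets_borel[OF _ fund_borel]) simp
  hence sets: "A \<inter> (\<lambda>x. t - x) -` fund \<in> sets borel" "{x. t - x \<in> A} \<in> sets borel"
    by measurable
  have eq: "{x. t - x \<in> A} \<inter> fund = (\<lambda>x. t - x) -` (A \<inter> (\<lambda>x. t - x) -` fund)"
    by (rule set_eqI) simp
  have "measure torus_uniform {x. t - x \<in> A} = measure lborel ({x. t - x \<in> A} \<inter> fund)"
    by (rule measure_torus_uniform[OF sets(2)])
  also have "\<dots> = measure lborel (A \<inter> (\<lambda>x. t - x) -` fund)"
    unfolding measure_def eq emeasure_lborel_reflect[OF sets(1)] by (rule refl)
  also have "\<dots> = measure torus_uniform A"
  proof (rule measure_torus_uniform_domain[symmetric])
    fix x
    obtain z where z: "z \<in> lattice" "t - x - z \<in> fund"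
      using fund_translate_exists by blast
    show "\<exists>!z. z \<in> lattice \<and> x + z \<in> (\<lambda>x. t - x) -` fund"
    proof (rule ex1I[of _ z])
      fix y assume "y \<in> lattice \<and> x + y \<in> (\<lambda>x. t - x) -` fund"
      thus "y = z"
        using fund_translate_unique[of y z "t - x"] z by (auto simp: algebra_simps)
    qed (use z in \<open>auto simp: algebra_simps\<close>)
  qed (rule assms dom | assumption)+
  finally show ?thesis .
qed

section \<open>Areas of torus discs and thin annuli\<close>

lemma measure_torus_ball:
  assumes "0 \<le> R" "R \<le> 1 / 2"
  shows "measure torus_uniform {x. torus_norm x < R} = pi * R\<^sup>2"
proof -
  \<comment> \<open>\<open>F\<close> is the square from -1/2 to 1/2 around the origin. As
    \<open>R\<close> is at most 1/2, the Euclidean disc fits into it, and no other lattice translate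
    of the disc meets it.\<close>
  define F where "F = (\<lambda>x. centre + x) -` fund"
  have [measurable]: "F \<in> sets borel"
    unfolding F_def by (rule measurable_sets_borel[OF _ fund_borel]) simp
  have "measure torus_uniform {x. torus_norm x < R} = measure lborel ({x. torus_norm x < R} \<inter> F)"
  proof (rule measure_torus_uniform_domain)
    fix x
    obtain z where z: "z \<in> lattice" "centre + x - z \<in> fund"
      using fund_translate_exists by blast
    show "\<exists>!z. z \<in> lattice \<and> x + z \<in> F"
    proof (rule ex1I[of _ "- z"])
      fix y assume "y \<in> lattice \<and> x + y \<in> F"
      thus "y = - z"
        using fund_translate_unique[of "- y" z "centre + x"] z
        by (auto simp: minus_lattice algebra_simps F_def)
    qed (use z in \<open>auto simp: minus_lattice algebra_simps F_def\<close>)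
  qed (auto simp: torus_norm_plus_lattice)
  also have "{x. torus_norm x < R} \<inter> F = ball 0 R"
  proof (intro equalityI subsetI)
    fix x :: "real \<times> real" assume x: "x \<in> ball 0 R"
    obtain s t where [simp]: "x = (s, t)" by (metis surj_pair)
    have "\<bar>s\<bar> \<le> norm x" "\<bar>t\<bar> \<le> norm x"
      by (simp_all add: norm_prod_def)
    hence "x \<in> F"
      using x assms by (auto simp: F_def fund_def centre_def)
    thus "x \<in> {x. torus_norm x < R} \<inter> F"
      using x torus_norm_le_norm[of x] by simp
  next
    fix x assume x: "x \<in> {x. torus_norm x < R} \<inter> F"
    then obtain z where z: "z \<in> lattice" "norm (x - z) < R"
      unfolding torus_norm_less_iff by blast
    obtain s t where xz: "x - z = (s, t)" by (metis surj_pair)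
    have "\<bar>s\<bar> \<le> norm (x - z)" "\<bar>t\<bar> \<le> norm (x - z)"
      by (simp_all add: xz norm_prod_def)
    hence "centre + x - z \<in> fund"
      using z assms xz by (auto simp: fund_def centre_def add_diff_eq[symmetric])
    hence "z = 0"
      using fund_translate_unique[of z 0 "centre + x"] z zero_lattice x by (simp add: F_def)
    thus "x \<in> ball 0 R" using z by simp
  qed
  also have "measure lborel (ball 0 R :: (real \<times> real) set) = pi * R\<^sup>2"
    using assms content_ball[of R "0 :: real \<times> real"] by (simp add: unit_ball_vol_2 power2_eq_square)
  finally show ?thesis .
qed

lemma null_torus_sphere: "measure torus_uniform {x. torus_norm x = r} = 0"
proof -
  have *: "sphere z r \<in> null_sets lborel" for z :: "real \<times> real"
    using negligible_sphere[of z r]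
    by (simp add: negligible_iff_null_sets null_sets_completion_iff)
  have "{x. torus_norm x = r} \<subseteq> (\<Union>z\<in>lattice. sphere z r)"
  proof
    fix x assume "x \<in> {x. torus_norm x = r}"
    moreover obtain z where "z \<in> lattice" "torus_norm x = norm (x - z)"
      using torus_norm_attained by metis
    ultimately show "x \<in> (\<Union>z\<in>lattice. sphere z r)"
      by (intro UN_I[of z]) (simp_all add: dist_norm norm_minus_commute)
  qed
  moreover have "(\<Union>z\<in>lattice. sphere z r) \<in> null_sets lborel"
    using countable_lattice * by (intro null_sets_UN') auto
  ultimately have "{x. torus_norm x = r} \<inter> fund \<in> null_sets lborel"
    by (intro null_sets_subset[of _ _ "{x. torus_norm x = r} \<inter> fund"]) auto
  thus ?thesis
    by (subst measure_torus_uniform) (auto simp: measure_def)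
qed

text \<open>The closed annuli of half-width \<open>1/(n+1)\<close> decrease to a torus circle, which
  is null, so their areas tend to 0 by continuity from above.\<close>

lemma thin_torus_annulus:
  assumes "e > 0" "d > 0"
  shows "\<exists>\<sigma>>0. \<sigma> < d \<and> measure torus_uniform {x. \<bar>torus_norm x - r\<bar> \<le> \<sigma>} < e"
proof -
  define X where "X n = {x. \<bar>torus_norm x - r\<bar> \<le> inverse (real (Suc n))}" for n
  have lim0: "(\<lambda>n. inverse (real (Suc n))) \<longlonglongrightarrow> 0"
    by (rule LIMSEQ_inverse_real_of_nat)
  have "(\<lambda>n. measure torus_uniform (X n)) \<longlonglongrightarrow> measure torus_uniform (\<Inter>n. X n)"
  proof (rule torus.finite_Lim_measure_decseq)
    show "decseq X"
    proof (rule decseq_SucI)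
      have "inverse (real (Suc (Suc n))) \<le> inverse (real (Suc n))" for n
        by (intro le_imp_inverse_le) auto
      thus "X (Suc n) \<subseteq> X n" for n
        unfolding X_def by (auto intro: order_trans)
    qed
  qed (auto simp: X_def)
  also have "(\<Inter>n. X n) = {x. torus_norm x = r}"
  proof (intro equalityI subsetI)
    fix x assume "x \<in> (\<Inter>n. X n)"
    hence "\<bar>torus_norm x - r\<bar> \<le> 0"
      by (intro LIMSEQ_le_const[OF lim0]) (auto simp: X_def)
    thus "x \<in> {x. torus_norm x = r}" by simp
  qed (auto simp: X_def)
  finally have "eventually (\<lambda>n. measure torus_uniform (X n) < e) sequentially"
    using assms by (intro order_tendstoD) (auto simp: null_torus_sphere)
  moreover have "eventually (\<lambda>n. inverse (real (Suc n)) < d) sequentially"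
    using lim0 assms by (intro order_tendstoD)
  ultimately have "eventually (\<lambda>n. measure torus_uniform (X n) < e \<and> inverse (real (Suc n)) < d) sequentially"
    by eventually_elim auto
  then obtain n where "measure torus_uniform (X n) < e" "inverse (real (Suc n)) < d"
    by (auto simp: eventually_sequentially)
  thus ?thesis
    by (intro exI[of _ "inverse (real (Suc n))"]) (auto simp: X_def)
qed

section \<open>Numbers of sample points in a region\<close>

definition occupancy :: "nat \<Rightarrow> (nat \<Rightarrow> real \<times> real) \<Rightarrow> (real \<times> real) set \<Rightarrow> nat" where
  "occupancy n x A = card {i. i < n \<and> x i \<in> A}"

lemma prob_space_torus_sample: "prob_space (torus_sample n)"
  unfolding torus_sample_def by (intro prob_space_PiM prob_space_torus_uniform)

text \<open>Hoeffding's inequality for the indicators of the events that the i-th point lies in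
  \<open>A\<close>.\<close>

lemma occupancy_deviation:
  fixes A :: "(real \<times> real) set" and e :: real
  assumes [measurable]: "A \<in> sets borel" and "n > 0" "e > 0"
  shows "{x \<in> space (torus_sample n). \<bar>real (occupancy n x A) - n * measure torus_uniform A\<bar> \<ge> e * n} \<in> sets (torus_sample n)"
    and "measure (torus_sample n)
           {x \<in> space (torus_sample n). \<bar>real (occupancy n x A) - n * measure torus_uniform A\<bar> \<ge> e * n}
         \<le> 2 * exp (-2 * e\<^sup>2 * n)"
proof -
  interpret prob_space "torus_sample n"
    by (rule prob_space_torus_sample)
  define f :: "real \<times> real \<Rightarrow> real" where "f = indicat_real A"
  have [measurable]: "f \<in> borel_measurable borel"
    unfolding f_def by measurable
  have comp: "distr (torus_sample n) torus_uniform (\<lambda>x. x i) = torus_uniform" if "i < n" for i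
    unfolding torus_sample_def using that
    by (intro distr_PiM_component prob_space_torus_uniform) auto
  have meas [measurable]: "(\<lambda>x. x i) \<in> torus_sample n \<rightarrow>\<^sub>M torus_uniform" if "i < n" for i
    unfolding torus_sample_def using that by (intro measurable_component_singleton) auto
  have measf [measurable]: "(\<lambda>x. f (x i)) \<in> borel_measurable (torus_sample n)" if "i < n" for i
    using meas[OF that] by (rule measurable_compose) measurable
  \<comment> \<open>Independence means that the joint law is the product of the marginals. The joint
    law is \<open>torus_sample n\<close> itself, since restricting to \<open>{..<n}\<close> changes
    nothing on its space.\<close>
  have "indep_vars (\<lambda>_. torus_uniform) (\<lambda>i x. x i) {..<n}"
  proof (subst indep_vars_iff_distr_eq_PiM')
    have "distr (torus_sample n) (Pi\<^sub>M {..<n} (\<lambda>i. torus_uniform)) (\<lambda>x. \<lambda>i\<in>{..<n}. x i)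
        = distr (torus_sample n) (torus_sample n) (\<lambda>x. x)"
      by (intro distr_cong) (auto simp: torus_sample_def space_PiM)
    also have "\<dots> = (\<Pi>\<^sub>M i\<in>{..<n}. distr (torus_sample n) torus_uniform (\<lambda>x. x i))"
      unfolding distr_id using comp by (subst torus_sample_def) (intro PiM_cong, auto)
    finally show "distr (torus_sample n) (Pi\<^sub>M {..<n} (\<lambda>i. torus_uniform)) (\<lambda>x. \<lambda>i\<in>{..<n}. x i)
        = (\<Pi>\<^sub>M i\<in>{..<n}. distr (torus_sample n) torus_uniform (\<lambda>x. x i))" .
  qed (use \<open>n > 0\<close> in auto)
  hence indep: "indep_vars (\<lambda>_. borel) (\<lambda>i x. f (x i)) {..<n}"
    by (rule indep_vars_compose2) measurable
  have f01: "f y \<in> {0..1}" for y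
    by (simp add: f_def indicator_def)
  have exp: "expectation (\<lambda>x. f (x i)) = measure torus_uniform A" if "i < n" for i
  proof -
    have "expectation (\<lambda>x. f (x i)) = integral\<^sup>L (distr (torus_sample n) torus_uniform (\<lambda>x. x i)) f"
      using meas[OF that] by (intro integral_distr[symmetric]) auto
    thus ?thesis
      using comp[OF that] by (simp add: f_def)
  qed
  interpret Hoeffding_ineq "torus_sample n" "{..<n}" "\<lambda>i x. f (x i)" "\<lambda>_. 0" "\<lambda>_. 1"
      "real n * measure torus_uniform A"
  proof unfold_locales
    show "real n * measure torus_uniform A \<equiv> \<Sum>i<n. expectation (\<lambda>x. f (x i))"
      using exp by (intro eq_reflection) simp
  qed (use indep f01 in auto)
  have occ: "real (occupancy n x A) = (\<Sum>i<n. f (x i))" for x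
  proof -
    have "(\<Sum>i<n. f (x i)) = (\<Sum>i | i < n \<and> x i \<in> A. 1)"
      by (intro sum.mono_neutral_cong_right) (auto simp: f_def indicator_def)
    thus ?thesis by (simp add: occupancy_def)
  qed
  show "{x \<in> space (torus_sample n). \<bar>real (occupancy n x A) - n * measure torus_uniform A\<bar> \<ge> e * n} \<in> sets (torus_sample n)"
    unfolding occ by measurable
  have "prob {x \<in> space (torus_sample n). \<bar>(\<Sum>i<n. f (x i)) - n * measure torus_uniform A\<bar> \<ge> e * n}
      \<le> 2 * exp (- 2 * (e * n)\<^sup>2 / (\<Sum>i<n. (1 - 0)\<^sup>2))"
    using assms by (intro Hoeffding_ineq_abs_ge) auto
  also have "- 2 * (e * n)\<^sup>2 / (\<Sum>i<n. (1 - 0)\<^sup>2) = -2 * e\<^sup>2 * n"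
    using \<open>n > 0\<close> by (simp add: power2_eq_square)
  finally show "prob {x \<in> space (torus_sample n). \<bar>real (occupancy n x A) - n * measure torus_uniform A\<bar> \<ge> e * n}
      \<le> 2 * exp (-2 * e\<^sup>2 * n)"
    unfolding occ .
qed

text \<open>\<open>E n\<close> need not be measurable: the measure of a non-measurable set is \<open>0\<close>.\<close>

lemma prob_tendsto_0_if_occupancies_prevent:
  fixes F :: "(real \<times> real) set set" and E :: "nat \<Rightarrow> (nat \<Rightarrow> real \<times> real) \<Rightarrow> bool" and e :: real
  assumes "finite F" "F \<subseteq> sets borel" "e > 0"
    and prevent: "eventually (\<lambda>n. \<forall>x.
      (\<forall>A\<in>F. \<bar>real (occupancy n x A) - n * measure torus_uniform A\<bar> < e * n) \<longrightarrow> \<not> E n x) sequentially"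
  shows "(\<lambda>n. \<P>(x in torus_sample n. E n x)) \<longlonglongrightarrow> 0"
proof (rule tendsto_sandwich[OF always_eventually _ tendsto_const])
  let ?B = "\<lambda>n A. {x \<in> space (torus_sample n). \<bar>real (occupancy n x A) - n * measure torus_uniform A\<bar> \<ge> e * n}"
  show "eventually (\<lambda>n. \<P>(x in torus_sample n. E n x) \<le> card F * (2 * exp (-2 * e\<^sup>2 * n))) sequentially"
    using prevent eventually_gt_at_top[of 0]
  proof eventually_elim
    case (elim n)
    interpret prob_space "torus_sample n"
      by (rule prob_space_torus_sample)
    have sets: "?B n A \<in> sets (torus_sample n)" if "A \<in> F" for A
      using that assms(2,3) elim(2) by (intro occupancy_deviation(1)) auto
    \<comment> \<open>Union bound: if \<open>E n x\<close> holds, some set in \<open>F\<close> has a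
      deviating count. Monotonicity asks for measurability of the larger set only.\<close>
    have "{x \<in> space (torus_sample n). E n x} \<subseteq> (\<Union>A\<in>F. ?B n A)"
      using elim(1) by (force simp: not_less[symmetric])
    hence "\<P>(x in torus_sample n. E n x) \<le> prob (\<Union>A\<in>F. ?B n A)"
      using sets assms(1) by (intro finite_measure_mono) auto
    also have "\<dots> \<le> (\<Sum>A\<in>F. prob (?B n A))"
      using sets assms(1) by (intro finite_measure_subadditive_finite) auto
    also have "\<dots> \<le> (\<Sum>A\<in>F. 2 * exp (-2 * e\<^sup>2 * n))"
      using assms(2,3) elim(2) by (intro sum_mono occupancy_deviation(2)) auto
    finally show ?case by simp
  qed
  show "(\<lambda>n. card F * (2 * exp (-2 * e\<^sup>2 * n))) \<longlonglongrightarrow> 0"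
    using \<open>e > 0\<close> by real_asymp
qed (auto simp: measure_nonneg)

section \<open>Antipodal holes\<close>

definition holes :: "real \<Rightarrow> (real \<times> real) set" where
  "holes R = (\<Union>c\<in>dlattice. ball c R)"

lemma holes_iff: "x \<in> holes R \<longleftrightarrow> (\<exists>c\<in>dlattice. norm (x - c) < R)"
  by (auto simp: holes_def dist_norm norm_minus_commute)

lemma open_holes: "open (holes R)"
  by (auto simp: holes_def)

lemma holes_add:
  assumes "z \<in> dlattice"
  shows "x + z \<in> holes R \<longleftrightarrow> x \<in> holes R"
proof
  assume "x + z \<in> holes R"
  then obtain c where "c \<in> dlattice" "norm (x + z - c) < R"
    by (auto simp: holes_iff)
  thus "x \<in> holes R"
    using assms by (auto simp: holes_iff algebra_simps intro!: bexI[of _ "c - z"] diff_dlattice)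
next
  assume "x \<in> holes R"
  then obtain c where "c \<in> dlattice" "norm (x - c) < R"
    by (auto simp: holes_iff)
  thus "x + z \<in> holes R"
    using assms by (auto simp: holes_iff intro!: bexI[of _ "c + z"] add_dlattice)
qed

lemma holes_diff: "z \<in> dlattice \<Longrightarrow> x - z \<in> holes R \<longleftrightarrow> x \<in> holes R"
  using holes_add[of z "x - z" R] by simp

lemma sqrt2_half_ge: "7071 / 10000 \<le> sqrt 2 / 2"
proof -
  have "14142 / 10000 \<le> sqrt 2"
    by (rule real_le_rsqrt) (simp add: power2_eq_square)
  thus ?thesis by simp
qed

text \<open>Convexity of the discs. The point \<open>y\<close> is within 0.06 of a lift
  \<open>w\<close> of the antipode of \<open>g\<close>, and reflecting in \<open>g\<close> or in
  \<open>w\<close> agrees up to \<open>dlattice\<close>. If \<open>y\<close> and its image both lay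
  in holes, the two centres would be less than 2 * 0.29 + 2 * 0.06 = 0.70 apart and hence equal, so
  the midpoint \<open>w\<close> would lie in the same disc. But \<open>w\<close> avoids the holes
  because \<open>g\<close> does.\<close>

lemma reflection_holes:
  assumes "R \<le> 29 / 100" "667 / 1000 \<le> s"
    and "g \<notin> holes R" "y \<in> holes R" "torus_norm (y - g) > s"
  shows "2 *\<^sub>R g - y \<notin> holes R"
proof
  assume "2 *\<^sub>R g - y \<in> holes R"
  have "torus_norm (y - g - centre) < 6 / 100"
    using assms by (intro torus_norm_diff_centre_less)
  then obtain z where z: "z \<in> lattice" "norm (y - g - centre - z) < 6 / 100"
    unfolding torus_norm_less_iff by blast
  define w where "w = g + (centre + z)"
  have cz: "centre + z \<in> dlattice"
    using z by (simp add: dlattice_iff)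
  have w: "w \<notin> holes R"
    using assms cz by (simp add: w_def holes_add)
  have "2 *\<^sub>R w - y = 2 *\<^sub>R g - y + ((centre + z) + (centre + z))"
    by (simp add: w_def scaleR_2)
  hence "2 *\<^sub>R w - y \<in> holes R"
    using \<open>2 *\<^sub>R g - y \<in> holes R\<close> cz by (simp only: holes_add add_dlattice)
  then obtain c' where c': "c' \<in> dlattice" "norm (2 *\<^sub>R w - y - c') < R"
    by (auto simp: holes_iff)
  obtain c where c: "c \<in> dlattice" "norm (y - c) < R"
    using assms by (auto simp: holes_iff)
  have "norm (y - w) < 6 / 100"
    using z by (simp add: w_def algebra_simps)
  moreover have "c - c' = (2 *\<^sub>R w - y - c') - (y - c) + 2 *\<^sub>R (y - w)"
    by (simp add: scaleR_2 algebra_simps)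
  moreover have "norm (u - v + 2 *\<^sub>R t) \<le> norm u + norm v + 2 * norm t" for u v t :: "real \<times> real"
    using norm_triangle_ineq[of "u - v" "2 *\<^sub>R t"] norm_triangle_ineq4[of u v] by simp
  ultimately have "norm (y - w) < 6 / 100"
      "norm (c - c') \<le> norm (2 *\<^sub>R w - y - c') + norm (y - c) + 2 * norm (y - w)"
    by metis+
  hence "norm (c - c') < 7071 / 10000"
    using c c' assms(1) by simp
  hence "c' = c"
    using norm_dlattice[OF diff_dlattice[OF c(1) c'(1)]] sqrt2_half_ge by fastforce
  have "2 *\<^sub>R (w - c) = (2 *\<^sub>R w - y - c) + (y - c)"
    by (simp add: scaleR_2 algebra_simps)
  hence "2 * norm (w - c) \<le> norm (2 *\<^sub>R w - y - c) + norm (y - c)"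
    by (metis norm_scaleR norm_triangle_ineq abs_numeral)
  with c c' \<open>c' = c\<close> have "norm (w - c) < R"
    by simp
  with w c show False
    by (auto simp: holes_iff)
qed

text \<open>A tangential step of length \<open>3 / 100\<close> increases the distance to the centre of a hole from
  \<open>R\<close> to at least \<open>sqrt (R\<^sup>2 + (3 / 100)\<^sup>2)\<close>, which exceeds \<open>R + (3 / 100)\<^sup>2\<close> as
  \<open>R \<le> 29 / 100\<close>; this is where the radius \<open>9 / 10000 = (3 / 100)\<^sup>2\<close> comes from.\<close>

lemma avoid_holes_tangent:
  fixes w c d :: "real \<times> real"
  assumes "0 < R" "R \<le> 29 / 100" "c \<in> dlattice" "norm (w - c) \<ge> R"
    and far: "\<And>c'. c' \<in> dlattice \<Longrightarrow> c' \<noteq> c \<Longrightarrow> norm (w - c') \<ge> 35 / 100"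
    and d: "norm d = 3 / 100" "inner (w - c) d = 0"
    and y: "norm (y - (w + d)) < 9 / 10000"
  shows "y \<notin> holes R"
proof
  assume "y \<in> holes R"
  then obtain c' where c': "c' \<in> dlattice" "norm (y - c') < R"
    by (auto simp: holes_iff)
  show False
  proof (cases "c' = c")
    case False
    \<comment> \<open>Other centres are too far away: 0.35 exceeds 0.29 + 0.0009 + 0.03.\<close>
    have "w - c' = (y - c') - (y - (w + d)) - d"
      by simp
    hence "norm (w - c') \<le> norm (y - c') + norm (y - (w + d)) + norm d"
      using norm_triangle_ineq4[of "y - c'" "y - (w + d)"] norm_triangle_ineq4[of "y - c' - (y - (w + d))" d]
      by simp
    thus False
      using far[OF c'(1) False] c'(2) y d assms(2) by simp
  next
    case True
    have "(norm ((w - c) + d))\<^sup>2 = (norm (w - c))\<^sup>2 + (3 / 100)\<^sup>2"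
      using d norm_add_Pythagorean[of "w - c" d] by (simp add: orthogonal_def)
    also have "\<dots> \<ge> R\<^sup>2 + (3 / 100)\<^sup>2"
      using assms by (intro add_right_mono power_mono) auto
    also have "R\<^sup>2 + (3 / 100)\<^sup>2 \<ge> (R + 9 / 10000)\<^sup>2"
      using assms(1,2) by (simp add: power2_eq_square algebra_simps)
    finally have "norm ((w - c) + d) \<ge> R + 9 / 10000"
      by (rule power2_le_imp_le) simp
    moreover have "norm ((w - c) + d) \<le> norm (y - c) + norm (y - (w + d))"
      using norm_triangle_ineq4[of "y - c" "y - (w + d)"] by (simp add: algebra_simps)
    ultimately show False
      using y c'(2) True by simp
  qed
qed

text \<open>The gap is a small disc about \<open>w + d\<close>, where \<open>w\<close> is the
  antipode of \<open>g\<close> and \<open>d\<close> is a tangential step around the only hole centre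
  that can be close to \<open>w\<close>. Both \<open>w + d\<close> and \<open>w - d\<close> stay
  clear of the holes, and reflection in \<open>w\<close> exchanges them; modulo the lattice this is
  reflection in \<open>g\<close>.\<close>

lemma exists_symmetric_gap:
  assumes "0 < R" "R \<le> 29 / 100" "g \<notin> holes R"
  obtains p where
    "\<And>y. torus_norm (y - p) < 9 / 10000 \<Longrightarrow>
       torus_norm (y - g) > 676 / 1000 \<and> y \<notin> holes R \<and> 2 *\<^sub>R g - y \<notin> holes R"
proof -
  define w where "w = g + centre"
  have w: "w \<notin> holes R"
    using assms centre_dlattice by (simp add: w_def holes_add)
  \<comment> \<open>Two centres within 0.35 of \<open>w\<close> would be less than 0.70 apart, so
    there is at most one. If there is none, any centre serves, and 0 is taken.\<close>
  obtain c where c: "c \<in> dlattice"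
    and far: "\<And>c'. c' \<in> dlattice \<Longrightarrow> c' \<noteq> c \<Longrightarrow> norm (w - c') \<ge> 35 / 100"
  proof (cases "\<exists>c\<in>dlattice. norm (w - c) < 35 / 100")
    case True
    then obtain c where c: "c \<in> dlattice" "norm (w - c) < 35 / 100" by blast
    have "norm (w - c') \<ge> 35 / 100" if "c' \<in> dlattice" "c' \<noteq> c" for c'
      using norm_dlattice[OF diff_dlattice[OF that(1) c(1)]] sqrt2_half_ge that(2) c(2)
        norm_triangle_ineq4[of "w - c" "w - c'"] by simp
    with c show ?thesis by (intro that[of c]) auto
  next
    case False
    thus ?thesis
      by (intro that[of 0]) (auto simp: lattice_dlattice zero_lattice not_less)
  qed
  have wc: "norm (w - c) \<ge> R"
    using w c by (force simp: holes_iff)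
  \<comment> \<open>\<open>w - c\<close>, nonzero since its length is at least \<open>R\<close>,
    turned by a right angle and rescaled to length 0.03.\<close>
  define d where "d = (3 / 100 / norm (w - c)) *\<^sub>R (- snd (w - c), fst (w - c))"
  have rot: "norm (- snd u, fst u) = norm u" "inner u (- snd u, fst u) = 0" for u :: "real \<times> real"
    by (simp_all add: norm_prod_def inner_prod_def add.commute)
  have d: "norm d = 3 / 100" "inner (w - c) d = 0"
    using wc assms(1) unfolding d_def norm_scaleR inner_scaleR_right rot by auto
  show ?thesis
  proof (rule that[of "w + d"])
    fix y assume y: "torus_norm (y - (w + d)) < 9 / 10000"
    then obtain z where z: "z \<in> lattice" "norm (y - (w + d) - z) < 9 / 10000"
      unfolding torus_norm_less_iff by blast
    have "y - z \<notin> holes R"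
      by (rule avoid_holes_tangent[OF assms(1,2) c wc far d])
         (use z(2) in \<open>simp_all add: algebra_simps\<close>)
    hence "y \<notin> holes R"
      using z by (simp add: holes_diff lattice_dlattice)
    have *: "2 *\<^sub>R w - (y - z) \<notin> holes R"
    proof (rule avoid_holes_tangent[OF assms(1,2) c wc far])
      have "2 *\<^sub>R w - (y - z) - (w + - d) = - (y - (w + d) - z)"
        by (simp add: scaleR_2)
      thus "norm (2 *\<^sub>R w - (y - z) - (w + - d)) < 9 / 10000"
        using z(2) by (metis norm_minus_cancel)
    qed (use d in auto)
    have "2 *\<^sub>R w - (y - z) = (2 *\<^sub>R g - y) + (2 *\<^sub>R centre + z)"
      by (simp add: w_def scaleR_2)
    moreover have "2 *\<^sub>R centre + z \<in> dlattice"
      by (intro lattice_dlattice add_lattice two_centre_lattice z)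
    ultimately have "2 *\<^sub>R g - y \<notin> holes R"
      using * by (simp only: holes_add not_False_eq_True)
    \<comment> \<open>The constant 0.676 comes from 0.7071 - 0.03 - 0.0009 = 0.6762.\<close>
    have "sqrt 2 / 2 \<le> torus_norm centre"
      by (rule torus_norm_centre)
    also have "\<dots> \<le> torus_norm (y - g) + torus_norm (centre - (y - g))"
      by (rule torus_norm_triangle_sub)
    also have "torus_norm (centre - (y - g)) = torus_norm ((y - (w + d)) + d)"
      unfolding w_def by (subst torus_norm_minus_commute) (simp add: algebra_simps)
    also have "\<dots> \<le> torus_norm (y - (w + d)) + norm d"
      using torus_norm_triangle torus_norm_le_norm[of d] by (meson add_left_mono order_trans)
    finally have "torus_norm (y - g) > 676 / 1000"
      using y d(1) sqrt2_half_ge by simp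
    with \<open>y \<notin> holes R\<close> \<open>2 *\<^sub>R g - y \<notin> holes R\<close>
    show "torus_norm (y - g) > 676 / 1000 \<and> y \<notin> holes R \<and> 2 *\<^sub>R g - y \<notin> holes R"
      by blast
  qed
qed

lemma sets_holes [measurable]: "holes R \<in> sets borel"
  using open_holes by (rule borel_open)

section \<open>The unseen region: holes against their complement\<close>

lemma measure_torus_translate_minus:
  assumes "A \<in> sets borel" "\<And>x z. z \<in> lattice \<Longrightarrow> x + z \<in> A \<longleftrightarrow> x \<in> A"
  shows "measure torus_uniform {x. x - t \<in> A} = measure torus_uniform A"
  using measure_torus_translate[of A "- t"] assms by simp

text \<open>Reflection in \<open>g\<close> preserves area and the distance to \<open>g\<close>, and
  carries the unseen part of the holes into the unseen part of the complement. Its image misses the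
  disc \<open>E\<close> of the symmetric gap, whose area is the surplus. The lower bound on
  \<open>s\<close> serves the reflection, the upper bound makes \<open>E\<close> unseen.\<close>

lemma holes_imbalance:
  assumes "0 < R" "R \<le> 29 / 100" "g \<notin> holes R" "667 / 1000 \<le> s" "s \<le> 676 / 1000"
  shows "measure torus_uniform ({y. s < torus_norm (y - g)} \<inter> holes R) + pi * (9 / 10000)\<^sup>2
    \<le> measure torus_uniform ({y. s < torus_norm (y - g)} - holes R)"
proof -
  define A where "A = {y. s < torus_norm (y - g)} \<inter> holes R"
  obtain p where p: "\<And>y. torus_norm (y - p) < 9 / 10000 \<Longrightarrow>
       torus_norm (y - g) > 676 / 1000 \<and> y \<notin> holes R \<and> 2 *\<^sub>R g - y \<notin> holes R"
    using exists_symmetric_gap[OF assms(1-3)] by blast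
  define E where "E = {y. torus_norm (y - p) < 9 / 10000}"
  have [measurable]: "A \<in> sets borel" "E \<in> sets borel"
    unfolding A_def E_def by measurable
  have A': "{y. 2 *\<^sub>R g - y \<in> A} \<in> sets borel"
    by measurable
  have periodic: "x + z \<in> A \<longleftrightarrow> x \<in> A" if "z \<in> lattice" for x z
    using that torus_norm_plus_lattice[OF that, of "x - g"]
    by (simp add: A_def holes_add lattice_dlattice algebra_simps)
  have "measure torus_uniform A + pi * (9 / 10000)\<^sup>2
      = measure torus_uniform {y. 2 *\<^sub>R g - y \<in> A} + measure torus_uniform E"
  proof -
    have "measure torus_uniform {y. 2 *\<^sub>R g - y \<in> A} = measure torus_uniform A"
      by (rule measure_torus_reflect) (auto simp: periodic)
    moreover have "measure torus_uniform E = pi * (9 / 10000)\<^sup>2"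
      using measure_torus_translate_minus[of "{x. torus_norm x < 9 / 10000}" p]
        measure_torus_ball[of "9 / 10000"]
      by (simp add: E_def torus_norm_plus_lattice)
    ultimately show ?thesis by simp
  qed
  also have "\<dots> = measure torus_uniform ({y. 2 *\<^sub>R g - y \<in> A} \<union> E)"
    using p A' by (intro torus.finite_measure_Union[symmetric]) (auto simp: A_def E_def)
  also have "\<dots> \<le> measure torus_uniform ({y. s < torus_norm (y - g)} - holes R)"
  proof (rule torus.finite_measure_mono)
    show "{y. 2 *\<^sub>R g - y \<in> A} \<union> E \<subseteq> {y. s < torus_norm (y - g)} - holes R"
    proof
      fix y assume "y \<in> {y. 2 *\<^sub>R g - y \<in> A} \<union> E"
      thus "y \<in> {y. s < torus_norm (y - g)} - holes R"
      proof
        assume "y \<in> {y. 2 *\<^sub>R g - y \<in> A}"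
        hence y: "s < torus_norm (2 *\<^sub>R g - y - g)" "2 *\<^sub>R g - y \<in> holes R"
          by (simp_all add: A_def)
        from reflection_holes[OF assms(2,4,3) y(2,1)] have "y \<notin> holes R"
          by simp
        moreover have "2 *\<^sub>R g - y - g = g - y"
          by (simp add: scaleR_2)
        ultimately show ?thesis
          using y(1) torus_norm_minus_commute[of g y] by (simp only: mem_Collect_eq Diff_iff) simp
      next
        assume "y \<in> E"
        thus ?thesis using p[of y] assms(5) by (auto simp: E_def)
      qed
    qed
  qed measurable
  finally show ?thesis by (simp add: A_def)
qed

text \<open>For use when \<open>g\<close> is only a net point near the actual vertex: the smaller
  radius overestimates what the vertex misses of the holes, the larger one underestimates what it
  misses of the complement. The annulus pays for the difference.\<close>

lemma holes_imbalance_annulus: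
  assumes "0 < R" "R \<le> 29 / 100" "g \<notin> holes R" "667 / 1000 \<le> r - \<sigma>" "r + \<sigma> \<le> 676 / 1000" "0 \<le> \<sigma>"
  shows "measure torus_uniform ({y. r - \<sigma> < torus_norm (y - g)} \<inter> holes R) + pi * (9 / 10000)\<^sup>2
    \<le> measure torus_uniform ({y. r + \<sigma> < torus_norm (y - g)} - holes R)
      + measure torus_uniform {y. \<bar>torus_norm y - r\<bar> \<le> \<sigma>}"
proof -
  have "measure torus_uniform ({y. r - \<sigma> < torus_norm (y - g)} \<inter> holes R) + pi * (9 / 10000)\<^sup>2
    \<le> measure torus_uniform ({y. r - \<sigma> < torus_norm (y - g)} - holes R)"
    using assms by (intro holes_imbalance) auto
  also have "\<dots> \<le> measure torus_uniform
      (({y. r + \<sigma> < torus_norm (y - g)} - holes R) \<union> {y. \<bar>torus_norm (y - g) - r\<bar> \<le> \<sigma>})"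
  proof (rule torus.finite_measure_mono)
    show "{y. r - \<sigma> < torus_norm (y - g)} - holes R
        \<subseteq> ({y. r + \<sigma> < torus_norm (y - g)} - holes R) \<union> {y. \<bar>torus_norm (y - g) - r\<bar> \<le> \<sigma>}"
      by (auto simp: abs_le_iff)
  qed measurable
  also have "\<dots> \<le> measure torus_uniform ({y. r + \<sigma> < torus_norm (y - g)} - holes R)
      + measure torus_uniform {y. \<bar>torus_norm (y - g) - r\<bar> \<le> \<sigma>}"
    by (intro measure_Un_le) measurable
  also have "measure torus_uniform {y. \<bar>torus_norm (y - g) - r\<bar> \<le> \<sigma>}
      = measure torus_uniform {y. \<bar>torus_norm y - r\<bar> \<le> \<sigma>}"
    using measure_torus_translate_minus[of "{y. \<bar>torus_norm y - r\<bar> \<le> \<sigma>}" g]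
    by (simp add: torus_norm_plus_lattice)
  finally show ?thesis .
qed

lemma holes_eq: "holes R = {x. torus_norm x < R} \<union> {x. torus_norm (x - centre) < R}"
proof (rule set_eqI)
  fix x
  show "x \<in> holes R \<longleftrightarrow> x \<in> {x. torus_norm x < R} \<union> {x. torus_norm (x - centre) < R}"
    by (simp add: holes_iff dlattice_def torus_norm_less_iff bex_Un diff_diff_eq del: split_paired_Ex)
qed

text \<open>The two discs are disjoint since their centres are at least 0.7071 apart and 2 * 0.29 is
  less.\<close>

lemma measure_holes:
  assumes "0 \<le> R" "R \<le> 29 / 100"
  shows "measure torus_uniform (holes R) = 2 * pi * R\<^sup>2"
proof -
  have "{x. torus_norm x < R} \<inter> {x. torus_norm (x - centre) < R} = {}"
  proof -
    have False if "torus_norm x < R" "torus_norm (x - centre) < R" for x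
      using that torus_norm_triangle_sub[of centre x] torus_norm_minus_commute[of centre x]
        torus_norm_centre sqrt2_half_ge assms by simp
    thus ?thesis by blast
  qed
  hence "measure torus_uniform (holes R)
      = measure torus_uniform {x. torus_norm x < R} + measure torus_uniform {x. torus_norm (x - centre) < R}"
    unfolding holes_eq by (intro torus.finite_measure_Union) measurable
  also have "measure torus_uniform {x. torus_norm (x - centre) < R} = measure torus_uniform {x. torus_norm x < R}"
    using measure_torus_translate_minus[of "{x. torus_norm x < R}" centre]
    by (simp add: torus_norm_plus_lattice)
  finally show ?thesis
    using assms by (simp add: measure_torus_ball)
qed

section \<open>Non-Hamiltonian subgraphs\<close>

text \<open>Along a Hamilton cycle, the successor map injects the positions of \<open>I\<close> into
  the positions outside \<open>I\<close>.\<close>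

lemma not_hamiltonian_if_large_independent:
  assumes "I \<subseteq> verts H" "2 * card I > card (verts H)"
    and indep: "\<And>e. e \<in> edges H \<Longrightarrow> \<not> e \<subseteq> I"
  shows "\<not> hamiltonian H"
proof
  assume "hamiltonian H"
  then obtain p where p: "distinct p" "set p = verts H" "length p \<ge> 3"
    and edge: "\<And>i. i < length p \<Longrightarrow> {p ! i, p ! (Suc i mod length p)} \<in> edges H"
    by (auto simp: hamiltonian_def hamilton_cycle_def)
  define N J where "N = length p" and "J = {i. i < N \<and> p ! i \<in> I}"
  have N: "N = card (verts H)"
    using p by (metis N_def distinct_card)
  have J: "J \<subseteq> {..<N}"
    by (auto simp: J_def)
  have "bij_betw ((!) p) {..<N} (verts H)"
    using p bij_betw_nth[of p] by (simp add: N_def)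
  moreover have "(!) p ` J = I"
  proof (intro equalityI subsetI)
    fix v assume "v \<in> I"
    moreover from this obtain i where "i < N" "p ! i = v"
      using assms(1) p(2) by (metis N_def in_set_conv_nth subsetD)
    ultimately show "v \<in> (!) p ` J"
      by (auto simp: J_def)
  qed (auto simp: J_def)
  ultimately have "bij_betw ((!) p) J I"
    using J bij_betw_subset by blast
  hence "card J = card I"
    by (rule bij_betw_same_card)
  have "card J \<le> card ({..<N} - J)"
  proof (rule card_inj_on_le)
    have "Suc i mod N = (if Suc i = N then 0 else Suc i)" if "i < N" for i
      using that by auto
    hence "i = j" if "i < N" "j < N" "Suc i mod N = Suc j mod N" for i j
      using that by (metis nat.inject nat.distinct(1))
    thus "inj_on (\<lambda>i. Suc i mod N) J"
      unfolding inj_on_def J_def by blast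
    show "(\<lambda>i. Suc i mod N) ` J \<subseteq> {..<N} - J"
    proof
      fix k assume "k \<in> (\<lambda>i. Suc i mod N) ` J"
      then obtain i where i: "i \<in> J" "k = Suc i mod N" by blast
      have "\<not> {p ! i, p ! k} \<subseteq> I"
        using edge[of i] i by (intro indep) (simp add: J_def N_def)
      moreover have "k < N" using i(1) by (simp add: i(2) J_def)
      ultimately show "k \<in> {..<N} - J"
        using i(1) by (simp add: J_def)
    qed
  qed simp
  also have "\<dots> = N - card J"
    using J by (simp add: card_Diff_subset finite_subset)
  finally show False
    using assms(2) N \<open>card J = card I\<close> by linarith
qed

lemma simple_geometric_graph: "simple_graph (geometric_graph n r x)"
  by (auto simp: simple_graph_def geometric_graph_def)

text \<open>Serves two graphs at once: \<open>Q\<close> is constantly true for the full graph, and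
  excludes pairs inside the independent set for the subgraph.\<close>

lemma degree_restricted_geometric_graph:
  assumes "i < n" and sym: "\<And>j. Q i j \<longleftrightarrow> Q j i"
    and E: "E = {{i, j} |i j. i < n \<and> j < n \<and> i \<noteq> j \<and> torus_dist (x i) (x j) \<le> r \<and> Q i j}"
  shows "card {e \<in> E. i \<in> e} = card {j. j < n \<and> j \<noteq> i \<and> torus_dist (x i) (x j) \<le> r \<and> Q i j}"
    (is "_ = card ?J")
proof -
  have "{e \<in> E. i \<in> e} = (\<lambda>j. {i, j}) ` ?J"
  proof (intro equalityI subsetI)
    fix e assume "e \<in> {e \<in> E. i \<in> e}"
    then obtain a b where e: "e = {a, b}" "a < n" "b < n" "a \<noteq> b" "torus_dist (x a) (x b) \<le> r" "Q a b" "i \<in> {a, b}"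
      by (auto simp: E)
    show "e \<in> (\<lambda>j. {i, j}) ` ?J"
    proof (cases "i = a")
      case True
      with e show ?thesis by auto
    next
      case False
      hence "b = i" using e by simp
      moreover have "torus_dist (x b) (x a) \<le> r"
        using e torus_norm_minus_commute[of "x a" "x b"] by (simp add: torus_dist_eq_norm)
      ultimately show ?thesis
        using e sym[of a] by (intro image_eqI[of _ _ a]) auto
    qed
  next
    fix e assume "e \<in> (\<lambda>j. {i, j}) ` ?J"
    thus "e \<in> {e \<in> E. i \<in> e}"
      using \<open>i < n\<close> by (auto simp: E)
  qed
  moreover have "inj_on (\<lambda>j. {i, j}) ?J"
    by (auto simp: inj_on_def doubleton_eq_iff)
  ultimately show ?thesis
    by (simp add: card_image)
qed

text \<open>All edges inside \<open>S\<close> are deleted. Vertices outside \<open>S\<close> keep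
  their full degree, so the degree condition concerns points of \<open>S\<close> only.\<close>

lemma exists_nonhamiltonian_beta_subgraph:
  fixes S :: "(real \<times> real) set" and \<beta> :: real
  assumes "\<beta> \<le> 1" and large: "2 * card {i. i < n \<and> x i \<in> S} > n"
    and deg: "\<And>i. i < n \<Longrightarrow> x i \<in> S \<Longrightarrow>
      \<beta> * card {j. j < n \<and> torus_dist (x i) (x j) \<le> r}
        \<le> card {j. j < n \<and> torus_dist (x i) (x j) \<le> r \<and> x j \<notin> S}"
    and "\<beta> \<ge> 0"
  shows "\<exists>H. beta_subgraph \<beta> H (geometric_graph n r x) \<and> \<not> hamiltonian H"
proof (intro exI conjI)
  let ?G = "geometric_graph n r x"
  define I where "I = {i. i < n \<and> x i \<in> S}"
  define H where "H = \<lparr>verts = {..<n}, edges = {e \<in> edges ?G. \<not> e \<subseteq> I}\<rparr>"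
  have verts: "verts H = {..<n}" "verts ?G = {..<n}"
    by (simp_all add: H_def geometric_graph_def)
  have "subgraph H ?G"
    using simple_geometric_graph[of n r x]
    by (auto simp: subgraph_def simple_graph_def H_def geometric_graph_def)
  moreover have "\<beta> * degree ?G i \<le> degree H i" if "i < n" for i
  proof -
    have degG: "degree ?G i = card {j. j < n \<and> j \<noteq> i \<and> torus_dist (x i) (x j) \<le> r}"
      unfolding degree_def
      using degree_restricted_geometric_graph[OF that, of "\<lambda>_ _. True" "edges ?G" x r]
      by (simp add: geometric_graph_def)
    have degH: "degree H i =
        card {j. j < n \<and> j \<noteq> i \<and> torus_dist (x i) (x j) \<le> r \<and> \<not> (x i \<in> S \<and> x j \<in> S)}"
      unfolding degree_def
      by (rule degree_restricted_geometric_graph[OF that])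
         (auto simp: H_def geometric_graph_def I_def)
    show ?thesis
    proof (cases "x i \<in> S")
      case True
      \<comment> \<open>The count on the right may include \<open>i\<close> itself, so it bounds the
        degree from above. In the count of points outside \<open>S\<close> below,
        \<open>j \<noteq> i\<close> is automatic.\<close>
      have "\<beta> * degree ?G i \<le> \<beta> * card {j. j < n \<and> torus_dist (x i) (x j) \<le> r}"
        unfolding degG using \<open>\<beta> \<ge> 0\<close> by (intro mult_left_mono of_nat_mono card_mono) auto
      also have "\<dots> \<le> card {j. j < n \<and> torus_dist (x i) (x j) \<le> r \<and> x j \<notin> S}"
        using deg that True by blast
      also have "{j. j < n \<and> torus_dist (x i) (x j) \<le> r \<and> x j \<notin> S}
          = {j. j < n \<and> j \<noteq> i \<and> torus_dist (x i) (x j) \<le> r \<and> \<not> (x i \<in> S \<and> x j \<in> S)}"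
        using True by auto
      finally show ?thesis by (simp add: degH)
    next
      case False
      thus ?thesis
        unfolding degG degH using \<open>\<beta> \<le> 1\<close> by (auto intro: mult_left_le_one_le simp: assms)
    qed
  qed
  ultimately show "beta_subgraph \<beta> H ?G"
    by (auto simp: beta_subgraph_def verts)
  show "\<not> hamiltonian H"
  proof (rule not_hamiltonian_if_large_independent)
    show "I \<subseteq> verts H" "card (verts H) < 2 * card I"
      using large by (auto simp: verts I_def)
  qed (simp add: H_def)
qed

section \<open>From typical point counts to a subgraph without Hamilton cycle\<close>

lemma finite_net_outside_holes:
  assumes "\<sigma> > 0"
  obtains C where "finite C" "C \<subseteq> - holes R"
    "\<And>v. v \<notin> holes R \<Longrightarrow> \<exists>g\<in>C. torus_norm (v - g) < \<sigma>"
proof -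
  \<comment> \<open>The closed unit square minus the open holes is compact and meets every lattice
    class outside the holes. Net points are taken from \<open>K\<close>, because the imbalance
    estimate applies only at points outside the holes.\<close>
  define K where "K = cbox 0 (1, 1) - holes R"
  have "compact K"
    unfolding K_def by (intro compact_diff compact_cbox open_holes)
  moreover have "K \<subseteq> (\<Union>c\<in>K. ball c \<sigma>)"
    using assms by auto
  ultimately obtain C where C: "C \<subseteq> K" "finite C" "K \<subseteq> (\<Union>c\<in>C. ball c \<sigma>)"
    using compactE_image[of K K "\<lambda>c. ball c \<sigma>"] by blast
  show ?thesis
  proof (rule that[of C])
    fix v assume v: "v \<notin> holes R"
    obtain z where z: "z \<in> lattice" "v - z \<in> fund"
      using fund_translate_exists by blast
    have "fund \<subseteq> cbox 0 (1, 1)"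
      by (auto simp: fund_def cbox_Pair_eq zero_prod_def)
    hence "v - z \<in> K"
      using z v by (auto simp: K_def holes_diff lattice_dlattice)
    then obtain g where g: "g \<in> C" "norm (v - z - g) < \<sigma>"
      using C(3) by (force simp: dist_norm norm_minus_commute)
    moreover have "v - z - g = v - g - z" by simp
    ultimately show "\<exists>g\<in>C. torus_norm (v - g) < \<sigma>"
      using z(1) unfolding torus_norm_less_iff by metis
  qed (use C in \<open>auto simp: K_def\<close>)
qed

lemma occupancy_mono: "A \<subseteq> B \<Longrightarrow> occupancy n x A \<le> occupancy n x B"
  unfolding occupancy_def by (intro card_mono) auto

lemma occupancy_UNIV: "occupancy n x UNIV = n"
  by (simp add: occupancy_def)

lemma occupancy_split: "occupancy n x A = occupancy n x (A \<inter> B) + occupancy n x (A - B)"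
  unfolding occupancy_def by (subst card_Un_disjoint[symmetric]) (auto intro!: arg_cong[of _ _ card])

text \<open>Error budget, in units of \<open>b * n\<close> with \<open>b\<close> the area of the
  gap: the unequal areas, the annulus and the random deviations together use up less than the
  surplus that the gap provides.\<close>

lemma nonhamiltonian_if_occupancies_typical:
  fixes R r \<sigma> b :: real
  defines "b \<equiv> pi * (9 / 10000)\<^sup>2"
  assumes R: "0 < R" "R \<le> 29 / 100" "2 * pi * R\<^sup>2 = 1 / 2 - b / 8"
    and r: "667 / 1000 \<le> r - \<sigma>" "r + \<sigma> \<le> 676 / 1000" "0 \<le> \<sigma>"
    and annulus: "measure torus_uniform {y. \<bar>torus_norm y - r\<bar> \<le> \<sigma>} < b / 8"
    and C: "C \<subseteq> - holes R" "\<And>v. v \<notin> holes R \<Longrightarrow> \<exists>g\<in>C. torus_norm (v - g) < \<sigma>"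
    and dev: "\<And>A. A \<in> insert (- holes R)
        ((\<lambda>g. {y. r + \<sigma> < torus_norm (y - g)} - holes R) ` C \<union>
         (\<lambda>g. {y. r - \<sigma> < torus_norm (y - g)} \<inter> holes R) ` C) \<Longrightarrow>
      \<bar>real (occupancy n x A) - n * measure torus_uniform A\<bar> < b / 16 * n"
    and n: "n > 0"
  shows "\<exists>H. beta_subgraph (1 / 2 + b / 16) H (geometric_graph n r x) \<and> \<not> hamiltonian H"
proof (rule exists_nonhamiltonian_beta_subgraph[where S = "- holes R"])
  have b: "0 < b" "b \<le> 1"
    using pi_less_4 by (simp_all add: b_def power2_eq_square)
  thus "1 / 2 + b / 16 \<le> 1" "0 \<le> 1 / 2 + b / 16" by simp_all
  have S: "measure torus_uniform (- holes R) = 1 / 2 + b / 8"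
    using torus.prob_compl[of "holes R"] R by (simp add: measure_holes Compl_eq_Diff_UNIV)
  have devS: "\<bar>real (occupancy n x (- holes R)) - n * (1 / 2 + b / 8)\<bar> < b / 16 * n"
    using dev[of "- holes R"] by (simp add: S)
  \<comment> \<open>The area excess \<open>b/8\<close> over one half outweighs the deviation
    \<open>b/16\<close>.\<close>
  have "real n < 2 * real (occupancy n x (- holes R))"
  proof -
    have "n * (1 / 2 + b / 8) - b / 16 * n = n / 2 + b / 16 * n"
      by (simp add: algebra_simps)
    moreover have "b / 16 * n > 0" using b n by simp
    ultimately show ?thesis using devS by linarith
  qed
  thus "n < 2 * card {i. i < n \<and> x i \<in> - holes R}"
    unfolding occupancy_def by linarith
  fix i assume "i < n" "x i \<in> - holes R"
  hence xi: "x i \<notin> holes R" by simp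
  with C obtain g where g: "g \<in> C" "torus_norm (x i - g) < \<sigma>" by blast
  have "g \<notin> holes R" using C g by blast
  define B where "B = {y. torus_norm (y - x i) \<le> r}"
  have dist: "torus_dist (x i) y \<le> r \<longleftrightarrow> y \<in> B" for y
    by (simp add: B_def torus_dist_eq_norm torus_norm_minus_commute[of "x i"])
  define d s where "d = occupancy n x (B \<inter> holes R)" and "s = occupancy n x (B - holes R)"
  have near: "torus_norm (y - x i) < torus_norm (y - g) + \<sigma>"
      "torus_norm (y - g) < torus_norm (y - x i) + \<sigma>" for y
    using torus_norm_triangle_sub[of "y - x i" "y - g"] torus_norm_triangle_sub[of "y - g" "y - x i"]
      g(2) torus_norm_minus_commute[of g "x i"] by simp_all
  have hole_count: "occupancy n x (holes R)
      \<le> d + occupancy n x ({y. r - \<sigma> < torus_norm (y - g)} \<inter> holes R)"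
  proof -
    have "holes R - B \<subseteq> {y. r - \<sigma> < torus_norm (y - g)} \<inter> holes R"
    proof
      fix y assume "y \<in> holes R - B"
      thus "y \<in> {y. r - \<sigma> < torus_norm (y - g)} \<inter> holes R"
        using near(1)[of y] by (simp add: B_def)
    qed
    thus ?thesis
      unfolding occupancy_split[of n x "holes R" B] d_def Int_commute[of B]
      by (intro add_left_mono occupancy_mono)
  qed
  have solid_count: "s + occupancy n x ({y. r + \<sigma> < torus_norm (y - g)} - holes R)
      \<le> occupancy n x (- holes R)"
  proof -
    have "- holes R \<inter> B = B - holes R" by auto
    moreover have "{y. r + \<sigma> < torus_norm (y - g)} - holes R \<subseteq> - holes R - B"
    proof
      fix y assume "y \<in> {y. r + \<sigma> < torus_norm (y - g)} - holes R"
      thus "y \<in> - holes R - B"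
        using near(2)[of y] by (simp add: B_def)
    qed
    ultimately show ?thesis
      unfolding occupancy_split[of n x "- holes R" B] s_def
      by (simp add: occupancy_mono)
  qed
  have total: "n = occupancy n x (holes R) + occupancy n x (- holes R)"
    using occupancy_split[of n x UNIV "holes R"] by (simp add: occupancy_UNIV Compl_eq_Diff_UNIV)
  \<comment> \<open>3/4 is what remains of 1 after 1/8 for the annulus and 1/16 for each of the two
    deviations.\<close>
  have far: "real (occupancy n x ({y. r - \<sigma> < torus_norm (y - g)} \<inter> holes R)) + b * n * (3 / 4)
      \<le> real (occupancy n x ({y. r + \<sigma> < torus_norm (y - g)} - holes R))"
  proof -
    let ?P = "{y. r - \<sigma> < torus_norm (y - g)} \<inter> holes R"
    let ?Q = "{y. r + \<sigma> < torus_norm (y - g)} - holes R"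
    have "measure torus_uniform ?P + b \<le> measure torus_uniform ?Q + b / 8"
      using holes_imbalance_annulus[OF R(1,2) \<open>g \<notin> holes R\<close> r] annulus
      unfolding b_def by linarith
    hence "n * (measure torus_uniform ?P + b) \<le> n * (measure torus_uniform ?Q + b / 8)"
      by (intro mult_left_mono) auto
    moreover have "\<bar>real (occupancy n x ?P) - n * measure torus_uniform ?P\<bar> < b / 16 * n"
        "\<bar>real (occupancy n x ?Q) - n * measure torus_uniform ?Q\<bar> < b / 16 * n"
      by (rule dev; use g(1) in blast)+
    moreover have "n * (measure torus_uniform ?P + b) = n * measure torus_uniform ?P + b * n"
        "n * (measure torus_uniform ?Q + b / 8) = n * measure torus_uniform ?Q + b * n / 8"
        "b / 16 * n = b * n / 16" "b * n * (3 / 4) = 3 * (b * n) / 4"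
      by (simp_all add: distrib_left)
    ultimately show ?thesis by linarith
  qed
  \<comment> \<open>The complement holds at most \<open>3/8 * b * n\<close> more sample points than
    the holes; subtracted from the \<open>3/4 * b * n\<close> above, this leaves more than the
    \<open>b/8 * n\<close> claimed.\<close>
  have imbalance: "real s + b / 8 * n \<le> real d"
  proof -
    have "n * (1 / 2 + b / 8) = n / 2 + b * n / 8" "b / 16 * n = b * n / 16"
        "b * n * (3 / 4) = 3 * (b * n) / 4" "b / 8 * n = b * n / 8"
      by (simp_all add: distrib_left)
    thus ?thesis
      using hole_count[THEN of_nat_mono, where 'a = real] solid_count[THEN of_nat_mono, where 'a = real]
        arg_cong[OF total, of real] far devS
      unfolding of_nat_add by linarith
  qed
  have card: "card {j. j < n \<and> torus_dist (x i) (x j) \<le> r} = d + s"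
    using occupancy_split[of n x B "holes R"] by (simp add: dist d_def s_def occupancy_def)
  have "d + s \<le> n"
    unfolding card[symmetric] using card_mono[of "{..<n}" "{j. j < n \<and> torus_dist (x i) (x j) \<le> r}"] by auto
  hence "b / 16 * real (d + s) \<le> b / 16 * n"
    using b by (intro mult_left_mono) auto
  \<comment> \<open>Equivalent to \<open>b/8 * (d + s) \<le> d - s\<close>, which follows from the
    imbalance and \<open>d + s \<le> n\<close>.\<close>
  hence "(1 / 2 + b / 16) * real (d + s) \<le> d"
  proof -
    have "2 * ((1 / 2 + b / 16) * real (d + s)) = real d + real s + 2 * (b / 16 * real (d + s))"
      by (simp add: distrib_right)
    also have "\<dots> \<le> real d + (real s + b / 8 * n)"
      using \<open>b / 16 * real (d + s) \<le> b / 16 * n\<close> by simp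
    also have "\<dots> \<le> real d + real d"
      by (rule add_left_mono[OF imbalance])
    finally show ?thesis by simp
  qed
  moreover have "card {j. j < n \<and> torus_dist (x i) (x j) \<le> r \<and> x j \<notin> - holes R} = d"
    by (simp add: dist d_def occupancy_def)
  ultimately show "(1 / 2 + b / 16) * card {j. j < n \<and> torus_dist (x i) (x j) \<le> r}
      \<le> card {j. j < n \<and> torus_dist (x i) (x j) \<le> r \<and> x j \<notin> - holes R}"
    by (simp only: card)
qed

theorem mainTheorem5:
  "\<exists>\<epsilon>::real. 0 < \<epsilon> \<and> \<epsilon> \<le> 1 / 2 \<and>
     (\<forall>C::real. C > 0 \<longrightarrow>
       (\<exists>r :: nat \<Rightarrow> real.
          (\<forall>n\<ge>1. r n \<ge> C * sqrt (ln (real n) / real n)) \<and>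
          \<not> ((\<lambda>n. \<P>(x in torus_sample n.
                 \<forall>H. beta_subgraph (1 / 2 + \<epsilon>) H (geometric_graph n (r n) x) \<longrightarrow> hamiltonian H))
               \<longlonglongrightarrow> 1)))"
proof -
  define b :: real where "b = pi * (9 / 10000)\<^sup>2"
  have b: "0 < b" "b \<le> 1"
    using pi_less_4 by (simp_all add: b_def power2_eq_square)
  \<comment> \<open>Chosen to give the holes area \<open>1/2 - b/8\<close>. As pi exceeds 3,
    \<open>R\<^sup>2\<close> is below 1/12, hence below 0.29 squared.\<close>
  define R where "R = sqrt ((1 / 2 - b / 8) / (2 * pi))"
  have R2: "R\<^sup>2 = (1 / 2 - b / 8) / (2 * pi)"
    using b by (simp add: R_def)
  have "0 < R" using b by (simp add: R_def)
  have area: "2 * pi * R\<^sup>2 = 1 / 2 - b / 8"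
    by (simp add: R2)
  have "R\<^sup>2 \<le> (29 / 100)\<^sup>2"
  proof -
    have "(1 / 2 - b / 8) / (2 * pi) \<le> (1 / 2) / (2 * 3)"
      using b pi_gt3 by (intro frac_le) auto
    also have "\<dots> \<le> (29 / 100)\<^sup>2"
      by (simp add: power2_eq_square)
    finally show ?thesis by (simp only: R2)
  qed
  hence "R \<le> 29 / 100" by (rule power2_le_imp_le) simp
  \<comment> \<open>The radius 0.671 with margin 0.003 keeps both comparison radii within the window
    from 0.667 to 0.676.\<close>
  obtain \<sigma> where \<sigma>: "0 < \<sigma>" "\<sigma> < 3 / 1000"
    "measure torus_uniform {y. \<bar>torus_norm y - 671 / 1000\<bar> \<le> \<sigma>} < b / 8"
    using thin_torus_annulus[of "b / 8" "3 / 1000" "671 / 1000"] b by auto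
  obtain N where N: "finite N" "N \<subseteq> - holes R"
    "\<And>v. v \<notin> holes R \<Longrightarrow> \<exists>g\<in>N. torus_norm (v - g) < \<sigma>"
    using finite_net_outside_holes[OF \<sigma>(1)] by metis
  define F where "F = insert (- holes R)
        ((\<lambda>g. {y. 671 / 1000 + \<sigma> < torus_norm (y - g)} - holes R) ` N \<union>
         (\<lambda>g. {y. 671 / 1000 - \<sigma> < torus_norm (y - g)} \<inter> holes R) ` N)"
  have F: "finite F" "F \<subseteq> sets borel"
    using N(1) by (auto simp: F_def)
  show ?thesis
  proof (intro exI[of _ "b / 16"] conjI allI impI)
    fix C :: real
    \<comment> \<open>The maximum secures the lower bound for every \<open>n\<close>, yet
      \<open>r\<close> is eventually the constant 0.671 because the first term tends to 0.\<close>
    define r where "r n = max (C * sqrt (ln (real n) / real n)) (671 / 1000)" for n :: nat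
    have "(\<lambda>n. C * sqrt (ln (real n) / real n)) \<longlonglongrightarrow> 0"
      by real_asymp
    hence "eventually (\<lambda>n. C * sqrt (ln (real n) / real n) < 671 / 1000) sequentially"
      by (intro order_tendstoD) auto
    hence ev: "eventually (\<lambda>n. r n = 671 / 1000 \<and> n > 0) sequentially"
      using eventually_gt_at_top[of 0] by eventually_elim (simp add: r_def)
    let ?E = "\<lambda>n x. \<forall>H. beta_subgraph (1 / 2 + b / 16) H (geometric_graph n (r n) x) \<longrightarrow> hamiltonian H"
    have "(\<lambda>n. \<P>(x in torus_sample n. ?E n x)) \<longlonglongrightarrow> 0"
    proof (rule prob_tendsto_0_if_occupancies_prevent[OF F])
      show "eventually (\<lambda>n. \<forall>x.
          (\<forall>A\<in>F. \<bar>real (occupancy n x A) - n * measure torus_uniform A\<bar> < b / 16 * n) \<longrightarrow> \<not> ?E n x)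
          sequentially"
        using ev
      proof eventually_elim
        case (elim n)
        have "\<exists>H. beta_subgraph (1 / 2 + b / 16) H (geometric_graph n (r n) x) \<and> \<not> hamiltonian H"
          if typical: "\<forall>A\<in>F. \<bar>real (occupancy n x A) - n * measure torus_uniform A\<bar> < b / 16 * n" for x
        proof -
          have r: "r n = 671 / 1000" using elim by blast
          show ?thesis
            unfolding r b_def
          proof (rule nonhamiltonian_if_occupancies_typical[of R "671 / 1000" \<sigma> N])
            fix A
            assume "A \<in> insert (- holes R)
              ((\<lambda>g. {y. 671 / 1000 + \<sigma> < torus_norm (y - g)} - holes R) ` N \<union>
               (\<lambda>g. {y. 671 / 1000 - \<sigma> < torus_norm (y - g)} \<inter> holes R) ` N)"
            thus "\<bar>real (occupancy n x A) - n * measure torus_uniform A\<bar> < pi * (9 / 10000)\<^sup>2 / 16 * n"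
              using typical unfolding F_def[symmetric] b_def[symmetric] by blast
          qed (use elim \<open>0 < R\<close> \<open>R \<le> 29 / 100\<close> area \<sigma> N(2,3) in \<open>simp_all add: b_def[symmetric]\<close>)
        qed
        thus ?case by blast
      qed
    qed (use b in auto)
    hence "\<not> (\<lambda>n. \<P>(x in torus_sample n. ?E n x)) \<longlonglongrightarrow> 1"
      using LIMSEQ_unique by fastforce
    thus "\<exists>r :: nat \<Rightarrow> real.
          (\<forall>n\<ge>1. r n \<ge> C * sqrt (ln (real n) / real n)) \<and>
          \<not> ((\<lambda>n. \<P>(x in torus_sample n.
                 \<forall>H. beta_subgraph (1 / 2 + b / 16) H (geometric_graph n (r n) x) \<longrightarrow> hamiltonian H))
               \<longlonglongrightarrow> 1)"
      by (intro exI[of _ r]) (auto simp: r_def)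
  qed (use b in auto)
qed

end
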